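(* Let $(\tilde{\mathcal{C}},\tilde\lambda)$ be a $(2n+3)$-dimensional contact manifold with canonical coordinates $(x,x^{n+1},p,p_{n+1},z)$, $x=\{x^1,\dots,x^n\}$, $p=\{p_1,\dots,p_n\}$, $\tilde\lambda=dz-p_a\,dx^a-p_{n+1}\,dx^{n+1}$. Let $\psi$ be a function of $x$, $p_{n+1}^{(0)}$ a non-zero constant, $\tilde\psi(x,x^{n+1})=\psi(x)+p_{n+1}^{(0)}x^{n+1}$, and let $F^1,\dots,F^n$ be functions of $x$ on the Legendre submanifold $\mathcal{A}_\psi$ generated by $\psi$ (parametrized by $x$), which do not identically vanish. Let $\tilde\Gamma$ be a function of one variable. Then the flow of the vector field $\dot x^a\,\partial/\partial x^a$, $\dot x^a=F^a(x)$, on $\mathcal{A}_\psi$ is lifted to $\tilde{\mathcal{C}}$ as the flow of the vector field $$\tilde X=\dot x^a\frac{\partial}{\partial x^a}+\dot x^{n+1}\frac{\partial}{\partial x^{n+1}}+\dot p_a\frac{\partial}{\partial p_a}+\dot p_{n+1}\frac{\partial}{\partial p_{n+1}}+\dot z\frac{\partial}{\partial z}$$ with $$\dot x^a=F^a(x),\quad \dot x^{n+1}=-\frac{1}{p_{n+1}^{(0)}}\frac{\partial\psi}{\partial x^j}F^j,\quad \dot p_{n+1}=\frac{d\tilde\Gamma}{d\tilde\Delta_0}\big(p_{n+1}^{(0)}-p_{n+1}\big),\quad \dot z=\tilde\Gamma(\tilde\Delta_0),$$ $$\dot p_a=\frac{p_{n+1}}{p_{n+1}^{(0)}}\Big(\frac{\partial^2\psi}{\partial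 x^a\partial x^j}F^j+\frac{\partial\psi}{\partial x^j}\frac{\partial F^j}{\partial x^a}\Big)-p_j\frac{\partial F^j}{\partial x^a}+\frac{d\tilde\Gamma}{d\tilde\Delta_0}\Big(\frac{\partial\psi}{\partial x^a}-p_a\Big),$$ $a\in\{1,\dots,n\}$. Equivalently, these can be written as $$\dot x^a=F^a(x),\quad \dot x^{n+1}=-\frac{1}{p_{n+1}^{(0)}}\frac{\partial\psi}{\partial x^j}F^j,\quad \dot p_{n+1}=\frac{d\tilde\Gamma}{d\tilde\Delta_0}\big(p_{n+1}^{(0)}-p_{n+1}\big),$$ $$\frac{d\tilde\Delta_a}{dt}=-\frac{\partial F^j}{\partial x^a}\tilde\Delta_j-\frac{d\tilde\Gamma}{d\tilde\Delta_0}\tilde\Delta_a,\qquad \frac{d\tilde\Delta_0}{dt}=-\tilde\Gamma(\tilde\Delta_0).$$ Moreover $\tilde X$ is the contact Hamiltonian vector field associated to the contact Hamiltonian $$\tilde h(x,x^{n+1},p,p_{n+1},z)=\tilde\Delta_a(x,p,p_{n+1})F^a(x)+\tilde\Gamma(\tilde\Delta_0(x,x^{n+1},z)),$$ and it satisfies $\mathcal{L}_{\tilde X}\tilde\psi=0$.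
   Context: All objects are smooth; repeated indices $a,j$ are summed over $1,\dots,n$. Put $$\tilde\Delta_0=\tilde\psi(x,x^{n+1})-z,\qquad \tilde\Delta_a=\frac{p_{n+1}}{p_{n+1}^{(0)}}\frac{\partial\psi}{\partial x^a}(x)-p_a .$$ A flow on $\tilde{\mathcal{C}}$ is a lift of a flow on $\mathcal{A}_\psi$ if the projection $\pi(x,x^{n+1},p,p_{n+1},z)=x$ intertwines them. The contact Hamiltonian vector field of a function $\tilde h$ on $\tilde{\mathcal{C}}$ is defined by $\iota_{\tilde X}\tilde\lambda=\tilde h$, $\iota_{\tilde X}d\tilde\lambda=-(d\tilde h-(\partial\tilde h/\partial z)\tilde\lambda)$; in coordinates, for $\mu=1,\dots,n+1$, $\dot x^\mu=-\partial\tilde h/\partial p_\mu$, $\dot p_\mu=\partial\tilde h/\partial x^\mu+p_\mu\,\partial\tilde h/\partial z$, $\dot z=\tilde h-\sum_{\mu=1}^{n+1}p_\mu\,\partial\tilde h/\partial p_\mu$. $\mathcal{L}$ denotes the Lie derivative. *)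

theory Defs
  imports "HOL-Analysis.Analysis"
begin

section \<open>Smooth functions and partial derivatives\<close>

primrec diff_order_on ::
  "nat \<Rightarrow> 'a::real_normed_vector set \<Rightarrow> ('a \<Rightarrow> 'b::real_normed_vector) \<Rightarrow> bool" where
  "diff_order_on 0 S f \<longleftrightarrow> continuous_on S f"
| "diff_order_on (Suc k) S f \<longleftrightarrow>
     (\<forall>x\<in>S. f differentiable (at x)) \<and>
     (\<forall>v. diff_order_on k S (\<lambda>x. frechet_derivative f (at x) v))"

text \<open>Only meant for open \<open>S\<close>.\<close>

definition smooth_on ::
  "'a::real_normed_vector set \<Rightarrow> ('a \<Rightarrow> 'b::real_normed_vector) \<Rightarrow> bool" where
  "smooth_on S f \<longleftrightarrow> (\<forall>k. diff_order_on k S f)"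

definition pd :: "'n::finite \<Rightarrow> (real^'n \<Rightarrow> real) \<Rightarrow> real^'n \<Rightarrow> real" where
  "pd a f x = frechet_derivative f (at x) (axis a 1)"


section \<open>Flows and lifts\<close>

text \<open>A vector field on a (sub)manifold \<open>M\<close> of a normed space is a map into that space; only its
  values on \<open>M\<close> matter. Flows are maximal local flows.\<close>

definition integral_curve_on ::
  "'a::real_normed_vector set \<Rightarrow> ('a \<Rightarrow> 'a) \<Rightarrow> real set \<Rightarrow> (real \<Rightarrow> 'a) \<Rightarrow> bool" where
  "integral_curve_on M X T c \<longleftrightarrow>
     open T \<and> is_interval T \<and>
     (\<forall>t\<in>T. c t \<in> M \<and> (c has_vector_derivative X (c t)) (at t))"

definition flow_reaches ::
  "'a::real_normed_vector set \<Rightarrow> ('a \<Rightarrow> 'a) \<Rightarrow> real \<Rightarrow> 'a \<Rightarrow> 'a \<Rightarrow> bool" where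
  "flow_reaches M X t q y \<longleftrightarrow>
     (\<exists>T c. integral_curve_on M X T c \<and> 0 \<in> T \<and> t \<in> T \<and> c 0 = q \<and> c t = y)"

definition flow_domain ::
  "'a::real_normed_vector set \<Rightarrow> ('a \<Rightarrow> 'a) \<Rightarrow> (real \<times> 'a) set" where
  "flow_domain M X = {(t, q). \<exists>y. flow_reaches M X t q y}"

definition flow ::
  "'a::real_normed_vector set \<Rightarrow> ('a \<Rightarrow> 'a) \<Rightarrow> real \<Rightarrow> 'a \<Rightarrow> 'a" where
  "flow M X t q = (THE y. flow_reaches M X t q y)"

text \<open>\<open>P\<close> intertwines the flow upstairs (on \<open>M'\<close>) with the flow on the base \<open>M\<close>.\<close>

definition is_flow_lift ::
  "'b::real_normed_vector set \<Rightarrow> ('b \<Rightarrow> 'b) \<Rightarrow> 'a::real_normed_vector set \<Rightarrow> ('a \<Rightarrow> 'a) \<Rightarrow>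
   ('b \<Rightarrow> 'a) \<Rightarrow> bool" where
  "is_flow_lift M' X' M X P \<longleftrightarrow>
     P ` M' \<subseteq> M \<and>
     (\<forall>(t, q) \<in> flow_domain M' X'.
        (t, P q) \<in> flow_domain M X \<and> P (flow M' X' t q) = flow M X t (P q))"

definition lie_derivative ::
  "('a::real_normed_vector \<Rightarrow> 'a) \<Rightarrow> ('a \<Rightarrow> real) \<Rightarrow> 'a \<Rightarrow> real" where
  "lie_derivative X f q = frechet_derivative f (at q) (X q)"


section \<open>The Legendre submanifold generated by a function\<close>

text \<open>\<open>legendre_map \<psi>\<close> is the parametrization by \<open>x\<close>, into the space with coordinates
  \<open>(x, p, z)\<close> and contact form \<open>dz - p\<^sub>a dx\<^sup>a\<close>.\<close>

definition legendre_map ::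
  "(real^'n::finite \<Rightarrow> real) \<Rightarrow> real^'n \<Rightarrow> (real^'n) \<times> (real^'n) \<times> real" where
  "legendre_map \<psi> x = (x, (\<chi> a. pd a \<psi> x), \<psi> x)"

definition legendre_submanifold ::
  "(real^'n::finite) set \<Rightarrow> (real^'n \<Rightarrow> real) \<Rightarrow> ((real^'n) \<times> (real^'n) \<times> real) set" where
  "legendre_submanifold \<Omega> \<psi> = legendre_map \<psi> ` \<Omega>"

text \<open>The vector field \<open>F\<^sup>a \<partial>/\<partial>x\<^sup>a\<close> on the Legendre submanifold, where \<open>\<partial>/\<partial>x\<^sup>a\<close> is the
  coordinate field of the parametrization: the push-forward of \<open>F\<close> along
  \<open>legendre_map \<psi>\<close>.\<close>

definition legendre_field ::
  "(real^'n::finite \<Rightarrow> real) \<Rightarrow> (real^'n \<Rightarrow> real^'n) \<Rightarrow>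
   (real^'n) \<times> (real^'n) \<times> real \<Rightarrow> (real^'n) \<times> (real^'n) \<times> real" where
  "legendre_field \<psi> F y = frechet_derivative (legendre_map \<psi>) (at (fst y)) (F (fst y))"


section \<open>The extended contact manifold in canonical coordinates\<close>

text \<open>Canonical coordinates \<open>(x, x\<^sup>n\<^sup>+\<^sup>1, p, p\<^sub>n\<^sub>+\<^sub>1, z)\<close>; tangent vectors are represented by
  their components in these coordinates.\<close>

type_synonym 'n cpt = "(real^'n) \<times> real \<times> (real^'n) \<times> real \<times> real"

abbreviation x_of :: "'n::finite cpt \<Rightarrow> real^'n" where
  "x_of q \<equiv> fst q"
abbreviation xlast_of :: "'n::finite cpt \<Rightarrow> real" where
  "xlast_of q \<equiv> fst (snd q)"
abbreviation p_of :: "'n::finite cpt \<Rightarrow> real^'n" where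
  "p_of q \<equiv> fst (snd (snd q))"
abbreviation plast_of :: "'n::finite cpt \<Rightarrow> real" where
  "plast_of q \<equiv> fst (snd (snd (snd q)))"
abbreviation z_of :: "'n::finite cpt \<Rightarrow> real" where
  "z_of q \<equiv> snd (snd (snd (snd q)))"

definition contact_form :: "'n::finite cpt \<Rightarrow> 'n cpt \<Rightarrow> real" where
  "contact_form q v =
     z_of v - (\<Sum>a\<in>UNIV. p_of q $ a * x_of v $ a) - plast_of q * xlast_of v"

text \<open>Exterior derivative of a one-form on a normed space, with the convention
  \<open>d\<alpha>(u,v) = u(\<alpha>(v)) - v(\<alpha>(u))\<close> for constant vector fields \<open>u\<close> and \<open>v\<close>.\<close>

definition ext_deriv ::
  "('a::real_normed_vector \<Rightarrow> 'a \<Rightarrow> real) \<Rightarrow> 'a \<Rightarrow> 'a \<Rightarrow> 'a \<Rightarrow> real" where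
  "ext_deriv \<alpha> q u v =
     frechet_derivative (\<lambda>q. \<alpha> q v) (at q) u - frechet_derivative (\<lambda>q. \<alpha> q u) (at q) v"

definition d_dz :: "('n::finite cpt \<Rightarrow> real) \<Rightarrow> 'n cpt \<Rightarrow> real" where
  "d_dz h q = frechet_derivative h (at q) (0, 0, 0, 0, 1)"

definition is_contact_hamiltonian_field ::
  "'n::finite cpt set \<Rightarrow> ('n cpt \<Rightarrow> real) \<Rightarrow> ('n cpt \<Rightarrow> 'n cpt) \<Rightarrow> bool" where
  "is_contact_hamiltonian_field U h X \<longleftrightarrow>
     (\<forall>q\<in>U. contact_form q (X q) = h q \<and>
        (\<forall>v. ext_deriv contact_form q (X q) v =
               - (frechet_derivative h (at q) v - d_dz h q * contact_form q v)))"

lemma ext_deriv_contact_form: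
  "ext_deriv contact_form q u v =
     (\<Sum>a\<in>UNIV. x_of u $ a * p_of v $ a - p_of u $ a * x_of v $ a)
     + (xlast_of u * plast_of v - plast_of u * xlast_of v)"
proof -
  have "((\<lambda>q. contact_form q v) has_derivative
          (\<lambda>u. - (\<Sum>a\<in>UNIV. p_of u $ a * x_of v $ a) - plast_of u * xlast_of v)) (at q)"
    for v :: "'a cpt"
    unfolding contact_form_def
    by (auto intro!: derivative_eq_intros bounded_linear.has_derivative[OF bounded_linear_vec_nth])
  then have "frechet_derivative (\<lambda>q. contact_form q v) (at q) =
          (\<lambda>u. - (\<Sum>a\<in>UNIV. p_of u $ a * x_of v $ a) - plast_of u * xlast_of v)"
    for v :: "'a cpt"
    by (rule frechet_derivative_at[symmetric])
  then show ?thesis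
    by (simp add: ext_deriv_def sum_subtractf algebra_simps)
qed

text \<open>The form is indeed a contact form (\<open>d\<lambda>\<close> is non-degenerate on its kernel).\<close>

lemma contact_form_nondegenerate:
  assumes "contact_form q u = 0"
    and "\<And>v. contact_form q v = 0 \<Longrightarrow> ext_deriv contact_form q u v = 0"
  shows "u = 0"
proof -
  have axis: "(\<Sum>b\<in>UNIV. f b * axis a 1 $ b) = f a" for f :: "'a \<Rightarrow> real" and a
    by (simp add: axis_def if_distrib cong: if_cong)
  have 1: "x_of u $ a = 0" for a
    using assms(2)[of "(0, 0, axis a 1, 0, 0)"]
    by (simp add: contact_form_def ext_deriv_contact_form axis)
  have 2: "xlast_of u = 0"
    using assms(2)[of "(0, 0, 0, 1, 0)"]
    by (simp add: contact_form_def ext_deriv_contact_form)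
  have 3: "p_of u $ a = 0" for a
    using assms(2)[of "(axis a 1, 0, 0, 0, p_of q $ a)"]
    by (simp add: contact_form_def ext_deriv_contact_form axis sum_negf)
  have 4: "plast_of u = 0"
    using assms(2)[of "(0, 1, 0, 0, plast_of q)"]
    by (simp add: contact_form_def ext_deriv_contact_form)
  have 5: "z_of u = 0"
    using assms(1) 1 2 by (simp add: contact_form_def)
  show ?thesis
    using 1 2 3 4 5 by (simp add: prod_eq_iff vec_eq_iff)
qed


section \<open>The objects of the lifting theorem\<close>

text \<open>\<open>p0\<close> is the constant \<open>p\<^sub>n\<^sub>+\<^sub>1\<close> with superscript \<open>(0)\<close>.\<close>

definition psi_tilde :: "(real^'n::finite \<Rightarrow> real) \<Rightarrow> real \<Rightarrow> 'n cpt \<Rightarrow> real" where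
  "psi_tilde \<psi> p0 q = \<psi> (x_of q) + p0 * xlast_of q"

definition Delta_0 :: "(real^'n::finite \<Rightarrow> real) \<Rightarrow> real \<Rightarrow> 'n cpt \<Rightarrow> real" where
  "Delta_0 \<psi> p0 q = psi_tilde \<psi> p0 q - z_of q"

definition Delta :: "(real^'n::finite \<Rightarrow> real) \<Rightarrow> real \<Rightarrow> 'n \<Rightarrow> 'n cpt \<Rightarrow> real" where
  "Delta \<psi> p0 a q = plast_of q / p0 * pd a \<psi> (x_of q) - p_of q $ a"

definition h_tilde ::
  "(real^'n::finite \<Rightarrow> real) \<Rightarrow> real \<Rightarrow> (real^'n \<Rightarrow> real^'n) \<Rightarrow> (real \<Rightarrow> real) \<Rightarrow> 'n cpt \<Rightarrow> real"
  where
  "h_tilde \<psi> p0 F \<Gamma> q =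
     (\<Sum>a\<in>UNIV. Delta \<psi> p0 a q * F (x_of q) $ a) + \<Gamma> (Delta_0 \<psi> p0 q)"

definition X_tilde ::
  "(real^'n::finite \<Rightarrow> real) \<Rightarrow> real \<Rightarrow> (real^'n \<Rightarrow> real^'n) \<Rightarrow> (real \<Rightarrow> real) \<Rightarrow> 'n cpt \<Rightarrow> 'n cpt"
  where
  "X_tilde \<psi> p0 F \<Gamma> q =
     (let x = x_of q; p = p_of q; r = plast_of q; G' = deriv \<Gamma> (Delta_0 \<psi> p0 q) in
       (F x,
        - (1 / p0) * (\<Sum>j\<in>UNIV. pd j \<psi> x * F x $ j),
        (\<chi> a. r / p0 * (\<Sum>j\<in>UNIV. pd a (pd j \<psi>) x * F x $ j + pd j \<psi> x * pd a (\<lambda>y. F y $ j) x)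
               - (\<Sum>j\<in>UNIV. p $ j * pd a (\<lambda>y. F y $ j) x)
               + G' * (pd a \<psi> x - p $ a)),
        G' * (p0 - r),
        \<Gamma> (Delta_0 \<psi> p0 q)))"

end

theory Submission
  imports Defs
begin

text \<open>
  The choice of \<open>dx\<^sup>n\<^sup>+\<^sup>1/dt\<close> makes \<open>\<psi>(x) + p0 x\<^sup>n\<^sup>+\<^sup>1\<close> a first integral, so \<open>\<Delta>\<^sub>0\<close> differs from \<open>-z\<close> by a
  constant along the flow. Given the equations for \<open>x\<close> and \<open>p\<^sub>n\<^sub>+\<^sub>1\<close>, the equation for \<open>p\<^sub>a\<close>
  becomes that for \<open>\<Delta>\<^sub>a\<close> by the chain rule and the symmetry of the second derivatives of \<open>\<psi>\<close>.
  The Hamiltonian identities follow by differentiating \<open>h\<close> in coordinates. Integral curves of the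
  lift project to integral curves of \<open>F\<close>; since flows are defined by a definite description, the
  projection intertwines them once integral curves are unique, which holds because all the fields
  are locally Lipschitz.
\<close>

section \<open>Consequences of smoothness\<close>

text \<open>On an open set a derivative at a point sees only values inside the set, so
  \<open>f\<close> and \<open>g\<close> have the same derivatives there at every order. This allows
  replacing the derivative of a component by the component of the derivative, which is known only on
  \<open>S\<close>.\<close>

lemma diff_order_on_cong:
  assumes "open S" "\<And>x. x \<in> S \<Longrightarrow> f x = g x"
  shows "diff_order_on k S f = diff_order_on k S g"
  using assms(2)
proof (induction k arbitrary: f g)
  case 0
  then show ?case by (simp cong: continuous_on_cong)
next
  case (Suc k)
  have tr: "(g' has_derivative D) (at x)"
    if "(f' has_derivative D) (at x)" "x \<in> S" "\<And>y. y \<in> S \<Longrightarrow> f' y = g' y" for x D f' g'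
    by (rule has_derivative_transform_within_open[OF that(1) \<open>open S\<close> that(2,3)])
  have eq: "(f has_derivative D) (at x) \<longleftrightarrow> (g has_derivative D) (at x)" if "x \<in> S" for x D
    using tr[of f D x g] tr[of g D x f] Suc.prems that by auto
  have "(\<forall>x\<in>S. f differentiable (at x)) = (\<forall>x\<in>S. g differentiable (at x))"
    by (simp add: differentiable_def eq)
  \<comment> \<open>\<open>frechet_derivative\<close> is a choice from the set of derivatives; by
    \<open>eq\<close> both choices are made from the same set and therefore coincide.\<close>
  moreover have "diff_order_on k S (\<lambda>x. frechet_derivative f (at x) v) =
      diff_order_on k S (\<lambda>x. frechet_derivative g (at x) v)" for v
    by (rule Suc.IH) (simp add: frechet_derivative_def eq)
  ultimately show ?case by simp
qed

lemma smooth_on_continuous_on: "smooth_on S f \<Longrightarrow> continuous_on S f"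
  unfolding smooth_on_def by (drule spec[of _ 0]) simp

lemma smooth_on_differentiable: "smooth_on S f \<Longrightarrow> x \<in> S \<Longrightarrow> f differentiable (at x)"
  unfolding smooth_on_def by (drule spec[of _ "Suc 0"]) simp

lemma smooth_on_has_derivative:
  "smooth_on S f \<Longrightarrow> x \<in> S \<Longrightarrow> (f has_derivative frechet_derivative f (at x)) (at x)"
  using smooth_on_differentiable frechet_derivative_works by blast

lemma smooth_on_frechet_derivative:
  "smooth_on S f \<Longrightarrow> smooth_on S (\<lambda>x. frechet_derivative f (at x) v)"
  unfolding smooth_on_def
proof
  fix k assume "\<forall>k. diff_order_on k S f"
  then show "diff_order_on k S (\<lambda>x. frechet_derivative f (at x) v)"
    by (auto dest!: spec[of _ "Suc k"])
qed

lemma smooth_on_pd: "smooth_on S f \<Longrightarrow> smooth_on S (pd a f)"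
  using smooth_on_frechet_derivative[of S f "axis a 1"] by (simp add: pd_def[abs_def])

lemma smooth_on_deriv:
  assumes "smooth_on S f" "x \<in> S"
  shows "(f has_real_derivative deriv f x) (at x)"
  using smooth_on_differentiable[OF assms]
  by (simp add: DERIV_deriv_iff_real_differentiable)

text \<open>Linearity of the total derivative, with the direction expanded in the standard basis.
  Later derivatives with respect to \<open>x\<close> are taken in this sum form, so that they can be
  compared with the coordinate formulas term by term.\<close>

lemma has_derivative_pd:
  fixes f :: "real^'n::finite \<Rightarrow> real"
  assumes "f differentiable (at x)"
  shows "(f has_derivative (\<lambda>v. \<Sum>a\<in>UNIV. v $ a * pd a f x)) (at x)"
proof -
  let ?D = "frechet_derivative f (at x)"
  have D: "(f has_derivative ?D) (at x)"
    using assms frechet_derivative_works by blast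
  then interpret bounded_linear ?D
    by (rule has_derivative_bounded_linear)
  have "?D v = (\<Sum>a\<in>UNIV. v $ a * pd a f x)" for v
  proof -
    have "?D v = ?D (\<Sum>a\<in>UNIV. v $ a *\<^sub>R axis a 1)"
      using basis_expansion[of v] by (simp add: scalar_mult_eq_scaleR)
    then show ?thesis
      by (simp add: sum scaleR pd_def)
  qed
  then have "?D = (\<lambda>v. \<Sum>a\<in>UNIV. v $ a * pd a f x)"
    by (rule ext)
  with D show ?thesis
    by (rule has_derivative_eq_rhs)
qed

lemma smooth_on_has_derivative_pd:
  fixes f :: "real^'n::finite \<Rightarrow> real"
  assumes "smooth_on S f" "x \<in> S"
  shows "(f has_derivative (\<lambda>v. \<Sum>a\<in>UNIV. v $ a * pd a f x)) (at x)"
  by (rule has_derivative_pd[OF smooth_on_differentiable[OF assms]])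

lemma frechet_derivative_nth:
  fixes f :: "'a::real_normed_vector \<Rightarrow> real^'n::finite"
  assumes "f differentiable (at x)"
  shows "frechet_derivative (\<lambda>y. f y $ i) (at x) v = frechet_derivative f (at x) v $ i"
proof -
  have "((\<lambda>y. f y $ i) has_derivative (\<lambda>v. frechet_derivative f (at x) v $ i)) (at x)"
    using assms frechet_derivative_works
    by (intro bounded_linear.has_derivative[OF bounded_linear_vec_nth]) blast
  from frechet_derivative_at[OF this, symmetric] show ?thesis
    by (rule fun_cong)
qed

lemma diff_order_on_nth:
  fixes f :: "'a::real_normed_vector \<Rightarrow> real^'n::finite"
  assumes "open S" "diff_order_on k S f"
  shows "diff_order_on k S (\<lambda>x. f x $ i)"
  using assms(2)
proof (induction k arbitrary: f)
  case 0
  then show ?case by (simp add: continuous_on_component)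
next
  case (Suc k)
  have "(\<lambda>y. f y $ i) differentiable (at x)" if "x \<in> S" for x
  proof -
    have "f differentiable (at x)"
      using Suc.prems that by simp
    then obtain D where "(f has_derivative D) (at x)"
      unfolding differentiable_def by blast
    from bounded_linear.has_derivative[OF bounded_linear_vec_nth this] show ?thesis
      unfolding differentiable_def by blast
  qed
  moreover have "diff_order_on k S (\<lambda>x. frechet_derivative (\<lambda>y. f y $ i) (at x) v)" for v
  proof -
    have "diff_order_on k S (\<lambda>x. frechet_derivative f (at x) v $ i)"
      by (rule Suc.IH) (use Suc.prems in simp)
    moreover have "frechet_derivative (\<lambda>y. f y $ i) (at x) v = frechet_derivative f (at x) v $ i"
      if "x \<in> S" for x
      by (rule frechet_derivative_nth) (use Suc.prems that in simp)
    ultimately show ?thesis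
      using diff_order_on_cong[OF \<open>open S\<close>] by (metis (no_types, lifting))
  qed
  ultimately show ?case by simp
qed

lemma smooth_on_nth:
  fixes f :: "'a::real_normed_vector \<Rightarrow> real^'n::finite"
  shows "open S \<Longrightarrow> smooth_on S f \<Longrightarrow> smooth_on S (\<lambda>x. f x $ i)"
  by (simp add: smooth_on_def diff_order_on_nth)


section \<open>Symmetry of second derivatives\<close>

text \<open>The mean value theorem is used twice: along \<open>u\<close> for the increment of
  \<open>f\<close> under translation by \<open>s *\<^sub>R v\<close>, then along \<open>v\<close>
  for the derivative of \<open>f\<close> in direction \<open>u\<close>. The second difference itself
  is symmetric in \<open>u\<close> and \<open>v\<close>.\<close>

lemma second_difference_mvt:
  fixes f :: "'a::real_normed_vector \<Rightarrow> real"
  assumes s: "s > 0"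
    and f: "\<And>y. y \<in> B \<Longrightarrow> f differentiable (at y)"
      "\<And>y. y \<in> B \<Longrightarrow> (\<lambda>z. frechet_derivative f (at z) u) differentiable (at y)"
    and B: "\<And>r t. 0 \<le> r \<Longrightarrow> r \<le> s \<Longrightarrow> 0 \<le> t \<Longrightarrow> t \<le> s \<Longrightarrow> x + r *\<^sub>R u + t *\<^sub>R v \<in> B"
  shows "\<exists>y\<in>B. f (x + s *\<^sub>R u + s *\<^sub>R v) - f (x + s *\<^sub>R u) - f (x + s *\<^sub>R v) + f x =
    s\<^sup>2 * frechet_derivative (\<lambda>z. frechet_derivative f (at z) u) (at y) v"
proof -
  have line: "((\<lambda>r. g (a + r *\<^sub>R w)) has_real_derivative
      frechet_derivative g (at (a + r *\<^sub>R w)) w) (at r)"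
    if "g differentiable (at (a + r *\<^sub>R w))" for g :: "'a \<Rightarrow> real" and a w r
  proof -
    have "((\<lambda>r. a + r *\<^sub>R w) has_vector_derivative w) (at r)"
      by (auto intro!: derivative_eq_intros)
    moreover have "(g has_derivative frechet_derivative g (at (a + r *\<^sub>R w))) (at (a + r *\<^sub>R w))"
      using that frechet_derivative_works by blast
    ultimately show ?thesis
      using vector_derivative_diff_chain_within[of "\<lambda>r. a + r *\<^sub>R w" w r UNIV g]
      by (simp add: o_def has_real_derivative_iff_has_vector_derivative has_derivative_at_withinI)
  qed
  let ?D = "\<lambda>z. frechet_derivative f (at z) u"
  \<comment> \<open>The second difference is the first difference \<open>\<phi> s - \<phi> 0\<close>
    of this function.\<close>
  define \<phi> where "\<phi> r = f (x + s *\<^sub>R v + r *\<^sub>R u) - f (x + r *\<^sub>R u)" for r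
  have "\<exists>r>0. r < s \<and> \<phi> s - \<phi> 0 = (s - 0) * (?D (x + s *\<^sub>R v + r *\<^sub>R u) - ?D (x + r *\<^sub>R u))"
  proof (rule MVT2[OF s])
    fix r :: real assume r: "0 \<le> r" "r \<le> s"
    have "f differentiable (at (x + s *\<^sub>R v + r *\<^sub>R u))"
      using f(1) B[of r s] r s by (simp add: add_ac)
    moreover have "f differentiable (at (x + r *\<^sub>R u))"
      using f(1) B[of r 0] r s by simp
    ultimately show "(\<phi> has_real_derivative ?D (x + s *\<^sub>R v + r *\<^sub>R u) - ?D (x + r *\<^sub>R u)) (at r)"
      unfolding \<phi>_def by (intro DERIV_diff line)
  qed
  then obtain r where r: "0 < r" "r < s"
    "\<phi> s - \<phi> 0 = s * (?D (x + s *\<^sub>R v + r *\<^sub>R u) - ?D (x + r *\<^sub>R u))" by auto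
  have "\<exists>t>0. t < s \<and> ?D (x + r *\<^sub>R u + s *\<^sub>R v) - ?D (x + r *\<^sub>R u + 0 *\<^sub>R v) =
      (s - 0) * frechet_derivative ?D (at (x + r *\<^sub>R u + t *\<^sub>R v)) v"
    by (rule MVT2[OF s]) (use r B f(2) in \<open>auto intro!: line\<close>)
  then obtain t where t: "0 < t" "t < s" "?D (x + r *\<^sub>R u + s *\<^sub>R v) - ?D (x + r *\<^sub>R u) =
      s * frechet_derivative ?D (at (x + r *\<^sub>R u + t *\<^sub>R v)) v" by auto
  have "\<phi> s - \<phi> 0 = s\<^sup>2 * frechet_derivative ?D (at (x + r *\<^sub>R u + t *\<^sub>R v)) v"
    using r(3) t(3) by (simp add: add_ac power2_eq_square)
  moreover have "\<phi> s - \<phi> 0 =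
      f (x + s *\<^sub>R u + s *\<^sub>R v) - f (x + s *\<^sub>R u) - f (x + s *\<^sub>R v) + f x"
    unfolding \<phi>_def by (simp add: add_ac)
  ultimately show ?thesis
    using B[of r t] r(1,2) t(1,2) by fastforce
qed

text \<open>Schwarz's theorem: one second difference equals \<open>s\<^sup>2\<close> times either
  mixed derivative, each at some point near \<open>x\<close>. Continuity of both at \<open>x\<close>
  then excludes a gap between their values there.\<close>

lemma frechet_derivative_commute:
  fixes f :: "'a::real_normed_vector \<Rightarrow> real"
  assumes "open S" "smooth_on S f" "x \<in> S"
  shows "frechet_derivative (\<lambda>z. frechet_derivative f (at z) u) (at x) v =
         frechet_derivative (\<lambda>z. frechet_derivative f (at z) v) (at x) u" (is "?H u v x = ?H v u x")
proof (rule ccontr)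
  assume ne: "?H u v x \<noteq> ?H v u x"
  \<comment> \<open>Half the gap: two numbers closer than \<open>e\<close> to the respective values
    at \<open>x\<close> cannot be equal.\<close>
  define e where "e = \<bar>?H u v x - ?H v u x\<bar> / 2"
  have "e > 0" using ne by (simp add: e_def)
  have near: "\<forall>\<^sub>F y in nhds x. \<bar>?H u v y - ?H u v x\<bar> < e" for u v
  proof -
    have "continuous_on S (?H u v)"
      by (intro smooth_on_continuous_on smooth_on_frechet_derivative assms)
    then have "isCont (?H u v) x"
      using assms by (simp add: continuous_on_eq_continuous_at)
    then have "(?H u v \<longlongrightarrow> ?H u v x) (nhds x)"
      unfolding isCont_def by (rule tendsto_at_iff_tendsto_nhds[THEN iffD1])
    from tendstoD[OF this \<open>e > 0\<close>] show ?thesis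
      by (simp add: dist_real_def)
  qed
  have "\<forall>\<^sub>F y in nhds x. y \<in> S \<and> \<bar>?H u v y - ?H u v x\<bar> < e \<and> \<bar>?H v u y - ?H v u x\<bar> < e"
    by (intro eventually_conj near eventually_nhds_in_open assms)
  then obtain d where d: "d > 0" "\<And>y. dist y x < d \<Longrightarrow>
      y \<in> S \<and> \<bar>?H u v y - ?H u v x\<bar> < e \<and> \<bar>?H v u y - ?H v u x\<bar> < e"
    unfolding eventually_nhds_metric by blast
  \<comment> \<open>Small enough that the whole parallelogram with sides
    \<open>s *\<^sub>R u\<close> and \<open>s *\<^sub>R v\<close> at \<open>x\<close> stays in the
    ball of radius \<open>d\<close>; the summand 1 keeps the denominator positive when both vectors
    vanish.\<close>
  define s where "s = d / (2 * (norm u + norm v + 1))"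
  have np: "norm u + norm v + 1 > 0" by (intro add_nonneg_pos) auto
  have s: "s > 0" using d np by (simp add: s_def)
  have sm: "s * (norm u + norm v) < d"
  proof -
    have "s * (norm u + norm v) \<le> s * (norm u + norm v + 1)" using s by simp
    also have "\<dots> = d / 2"
    proof -
      have "d / (2 * k) * k = d / 2" if "k > 0" for k using that by simp
      then show ?thesis using np unfolding s_def by blast
    qed
    finally show ?thesis using d by simp
  qed
  \<comment> \<open>Stated for general \<open>u'\<close> and \<open>v'\<close> with the same sum of
    norms, so that it serves both orders of \<open>u\<close> and \<open>v\<close>.\<close>
  have inB: "x + r *\<^sub>R u' + t *\<^sub>R v' \<in> ball x d"
    if "0 \<le> r" "r \<le> s" "0 \<le> t" "t \<le> s" "norm u' + norm v' = norm u + norm v" for r t u' v'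
  proof -
    have "norm (r *\<^sub>R u' + t *\<^sub>R v') \<le> r * norm u' + t * norm v'"
      using that(1-4) by (intro norm_triangle_le) simp
    also have "\<dots> \<le> s * norm u' + s * norm v'"
      using that(1-4) by (intro add_mono mult_right_mono) auto
    also have "\<dots> = s * (norm u + norm v)"
      unfolding that(5)[symmetric] by (rule distrib_left[symmetric])
    finally have "norm (x + r *\<^sub>R u' + t *\<^sub>R v' - x) < d"
      using sm by (simp add: add.assoc)
    then show ?thesis
      unfolding mem_ball dist_norm by (subst norm_minus_commute)
  qed
  have mvt: "\<exists>y\<in>ball x d. f (x + s *\<^sub>R u' + s *\<^sub>R v') - f (x + s *\<^sub>R u') - f (x + s *\<^sub>R v') + f x =
      s\<^sup>2 * ?H u' v' y" if "norm u' + norm v' = norm u + norm v" for u' v'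
  proof (rule second_difference_mvt[OF s])
    fix y assume "y \<in> ball x d"
    then have "y \<in> S" using d(2)[of y] by (simp add: dist_commute)
    then show "f differentiable (at y)" "(\<lambda>z. frechet_derivative f (at z) u') differentiable (at y)"
      using assms(2) by (auto intro!: smooth_on_differentiable smooth_on_frechet_derivative)
  qed (rule inB[OF _ _ _ _ that])
  have "f (x + s *\<^sub>R u + s *\<^sub>R v) - f (x + s *\<^sub>R u) - f (x + s *\<^sub>R v) + f x =
      f (x + s *\<^sub>R v + s *\<^sub>R u) - f (x + s *\<^sub>R v) - f (x + s *\<^sub>R u) + f x"
    by (simp add: add.assoc add.commute[of "s *\<^sub>R u"])
  moreover obtain y where y: "y \<in> ball x d"
    "f (x + s *\<^sub>R u + s *\<^sub>R v) - f (x + s *\<^sub>R u) - f (x + s *\<^sub>R v) + f x = s\<^sup>2 * ?H u v y"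
    using mvt[OF refl] by blast
  moreover obtain z where z: "z \<in> ball x d"
    "f (x + s *\<^sub>R v + s *\<^sub>R u) - f (x + s *\<^sub>R v) - f (x + s *\<^sub>R u) + f x = s\<^sup>2 * ?H v u z"
    using mvt[OF add.commute] by blast
  ultimately have "s\<^sup>2 * ?H u v y = s\<^sup>2 * ?H v u z"
    by simp
  then have "?H u v y = ?H v u z" "\<bar>?H u v y - ?H u v x\<bar> < e" "\<bar>?H v u z - ?H v u x\<bar> < e"
    using d(2)[of y] d(2)[of z] y(1) z(1) s by (simp_all add: dist_commute)
  then show False
    unfolding e_def by argo
qed

lemma pd_commute:
  assumes "open S" "smooth_on S f" "x \<in> S"
  shows "pd a (pd b f) x = pd b (pd a f) x"
  using frechet_derivative_commute[OF assms, of "axis b 1" "axis a 1"]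
  by (simp add: pd_def[abs_def])


section \<open>Uniqueness of integral curves\<close>

text \<open>Local Lipschitz continuity, written with a filter on pairs of points near
  \<open>x\<close>. Closure properties then follow by combining eventual estimates, without choosing
  neighbourhoods.\<close>

definition lipschitz_near ::
  "('a::real_normed_vector \<Rightarrow> 'b::real_normed_vector) \<Rightarrow> 'a \<Rightarrow> bool" where
  "lipschitz_near f x \<longleftrightarrow>
     (\<exists>L. \<forall>\<^sub>F (y, z) in nhds x \<times>\<^sub>F nhds x. norm (f y - f z) \<le> L * norm (y - z))"

text \<open>The constant may be enlarged to \<open>max L 0\<close> since it multiplies a norm.
  Nonnegativity is what makes later estimates monotone under multiplication.\<close>

lemma lipschitz_nearE:
  assumes "lipschitz_near f x"
  obtains L where "L \<ge> 0" "\<forall>\<^sub>F (y, z) in nhds x \<times>\<^sub>F nhds x. norm (f y - f z) \<le> L * norm (y - z)"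
proof -
  from assms obtain L where
    L: "\<forall>\<^sub>F (y, z) in nhds x \<times>\<^sub>F nhds x. norm (f y - f z) \<le> L * norm (y - z)"
    unfolding lipschitz_near_def by blast
  have "\<forall>\<^sub>F (y, z) in nhds x \<times>\<^sub>F nhds x. norm (f y - f z) \<le> max L 0 * norm (y - z)"
    using L
  proof eventually_elim
    case (elim p)
    have "L * norm (fst p - snd p) \<le> max L 0 * norm (fst p - snd p)"
      by (intro mult_right_mono) auto
    with elim show ?case by (simp add: case_prod_beta)
  qed
  then show ?thesis
    by (intro that[of "max L 0"]) simp_all
qed

lemma lipschitz_near_isCont:
  assumes "lipschitz_near f x"
  shows "isCont f x"
proof -
  obtain L where L: "\<forall>\<^sub>F (y, z) in nhds x \<times>\<^sub>F nhds x. norm (f y - f z) \<le> L * norm (y - z)"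
    using lipschitz_nearE[OF assms] .
  \<comment> \<open>Freezing the second point at \<open>x\<close> turns the estimate for pairs into
    one for single points.\<close>
  have "filterlim (\<lambda>y. (y, x)) (nhds x \<times>\<^sub>F nhds x) (nhds x)"
    by (intro filterlim_Pair filterlim_ident tendsto_const)
  from eventually_compose_filterlim[OF L this]
  have "\<forall>\<^sub>F y in nhds x. norm (f y - f x) \<le> L * norm (y - x)"
    by simp
  then have "\<forall>\<^sub>F y in at x. norm (f y - f x) \<le> L * norm (y - x)"
    unfolding eventually_at_filter by (rule eventually_mono) simp
  moreover have "((\<lambda>y. L * norm (y - x)) \<longlongrightarrow> 0) (at x)"
    by (auto intro!: tendsto_eq_intros)
  ultimately have "((\<lambda>y. f y - f x) \<longlongrightarrow> 0) (at x)"
    by (rule Lim_null_comparison)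
  then show ?thesis
    by (simp add: isCont_def LIM_zero_iff)
qed

text \<open>Pairs near \<open>x\<close> eventually lie in \<open>S \<times> S\<close>. This serves
  to pass from the Frechet derivative of \<Gamma> in direction 1 to \<open>deriv \<Gamma>\<close>,
  an identity available on \<open>J\<close>.\<close>

lemma lipschitz_near_cong:
  assumes "open S" "x \<in> S" "\<And>y. y \<in> S \<Longrightarrow> f y = g y" "lipschitz_near f x"
  shows "lipschitz_near g x"
proof -
  obtain L where L: "\<forall>\<^sub>F (y, z) in nhds x \<times>\<^sub>F nhds x. norm (f y - f z) \<le> L * norm (y - z)"
    using lipschitz_nearE[OF assms(4)] .
  have "\<forall>\<^sub>F p in nhds x \<times>\<^sub>F nhds x. p \<in> S \<times> S"
    unfolding nhds_prod[symmetric] using assms by (intro eventually_nhds_in_open open_Times) auto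
  with L have "\<forall>\<^sub>F (y, z) in nhds x \<times>\<^sub>F nhds x. norm (g y - g z) \<le> L * norm (y - z)"
    by eventually_elim (auto simp: assms(3))
  then show ?thesis
    unfolding lipschitz_near_def by blast
qed

section \<open>Base cases and closure properties of local Lipschitz continuity\<close>

lemma lipschitz_near_bounded_linear:
  assumes "bounded_linear f"
  shows "lipschitz_near f x"
proof -
  interpret bounded_linear f by fact
  obtain K where "\<And>x. norm (f x) \<le> norm x * K"
    using bounded by blast
  then have "norm (f y - f z) \<le> K * norm (y - z)" for y z
    unfolding diff[symmetric] mult.commute[of K] by blast
  then show ?thesis
    unfolding lipschitz_near_def by (auto intro!: exI[of _ K] always_eventually)
qed

lemma lipschitz_near_const: "lipschitz_near (\<lambda>y. c) x"
  unfolding lipschitz_near_def by (auto intro!: exI[of _ 0] always_eventually)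

lemma lipschitz_near_compose:
  assumes g: "lipschitz_near g x" and f: "lipschitz_near f (g x)"
  shows "lipschitz_near (\<lambda>y. f (g y)) x"
proof -
  obtain L where L: "L \<ge> 0"
    "\<forall>\<^sub>F (y, z) in nhds (g x) \<times>\<^sub>F nhds (g x). norm (f y - f z) \<le> L * norm (y - z)"
    using lipschitz_nearE[OF f] .
  obtain K where K: "\<forall>\<^sub>F (y, z) in nhds x \<times>\<^sub>F nhds x. norm (g y - g z) \<le> K * norm (y - z)"
    using lipschitz_nearE[OF g] .
  \<comment> \<open>Continuity of \<open>g\<close> carries pairs near \<open>x\<close> to pairs near
    \<open>g x\<close>, where the estimate for \<open>f\<close> applies.\<close>
  have "filterlim g (nhds (g x)) (nhds x)"
    using lipschitz_near_isCont[OF g] unfolding isCont_def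
    by (rule tendsto_at_iff_tendsto_nhds[THEN iffD1])
  then have "filterlim (\<lambda>p. (g (fst p), g (snd p))) (nhds (g x) \<times>\<^sub>F nhds (g x)) (nhds x \<times>\<^sub>F nhds x)"
    by (intro filterlim_Pair) (auto intro: filterlim_compose filterlim_fst filterlim_snd)
  from eventually_compose_filterlim[OF L(2) this] K
  have "\<forall>\<^sub>F (y, z) in nhds x \<times>\<^sub>F nhds x. norm (f (g y) - f (g z)) \<le> (L * K) * norm (y - z)"
  proof eventually_elim
    case (elim p)
    then have "norm (f (g (fst p)) - f (g (snd p))) \<le> L * norm (g (fst p) - g (snd p))"
      by simp
    also have "\<dots> \<le> L * (K * norm (fst p - snd p))"
      using elim L(1) by (intro mult_left_mono) (simp_all add: case_prod_beta)
    finally show ?case by (simp add: case_prod_beta mult.assoc)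
  qed
  then show ?thesis
    unfolding lipschitz_near_def by blast
qed

lemma lipschitz_near_add:
  assumes "lipschitz_near f x" "lipschitz_near g x"
  shows "lipschitz_near (\<lambda>y. f y + g y) x"
proof -
  obtain L where L: "\<forall>\<^sub>F (y, z) in nhds x \<times>\<^sub>F nhds x. norm (f y - f z) \<le> L * norm (y - z)"
    using lipschitz_nearE[OF assms(1)] .
  obtain K where K: "\<forall>\<^sub>F (y, z) in nhds x \<times>\<^sub>F nhds x. norm (g y - g z) \<le> K * norm (y - z)"
    using lipschitz_nearE[OF assms(2)] .
  from L K have "\<forall>\<^sub>F (y, z) in nhds x \<times>\<^sub>F nhds x.
      norm (f y + g y - (f z + g z)) \<le> (L + K) * norm (y - z)"
    by eventually_elim (auto simp: add_diff_add distrib_right intro!: norm_triangle_le)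
  then show ?thesis
    unfolding lipschitz_near_def by blast
qed

lemma lipschitz_near_scaleR:
  assumes "lipschitz_near f x" "lipschitz_near g x"
  shows "lipschitz_near (\<lambda>y. f y *\<^sub>R g y) x"
proof -
  obtain L where L: "L \<ge> 0" "\<forall>\<^sub>F (y, z) in nhds x \<times>\<^sub>F nhds x. norm (f y - f z) \<le> L * norm (y - z)"
    using lipschitz_nearE[OF assms(1)] .
  obtain K where K: "K \<ge> 0" "\<forall>\<^sub>F (y, z) in nhds x \<times>\<^sub>F nhds x. norm (g y - g z) \<le> K * norm (y - z)"
    using lipschitz_nearE[OF assms(2)] .
  \<comment> \<open>Products need bounded factors; by continuity each factor is eventually bounded
    by its norm at \<open>x\<close> plus 1.\<close>
  have bounded: "\<forall>\<^sub>F y in nhds x. norm (h y) \<le> norm (h x) + 1"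
    if "lipschitz_near h x" for h :: "'a \<Rightarrow> 'c::real_normed_vector"
  proof -
    have "filterlim h (nhds (h x)) (nhds x)"
      using lipschitz_near_isCont[OF that] unfolding isCont_def
      by (rule tendsto_at_iff_tendsto_nhds[THEN iffD1])
    then have "\<forall>\<^sub>F y in nhds x. dist (h y) (h x) < 1"
      by (rule tendstoD) simp
    then show ?thesis
    proof eventually_elim
      case (elim y)
      then show ?case
        using norm_triangle_ineq2[of "h y" "h x"] by (simp add: dist_norm)
    qed
  qed
  have "\<forall>\<^sub>F p in nhds x \<times>\<^sub>F nhds x. norm (f (fst p)) \<le> norm (f x) + 1"
    using eventually_compose_filterlim[OF bounded[OF assms(1)] filterlim_fst] .
  moreover have "\<forall>\<^sub>F p in nhds x \<times>\<^sub>F nhds x. norm (g (snd p)) \<le> norm (g x) + 1"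
    using eventually_compose_filterlim[OF bounded[OF assms(2)] filterlim_snd] .
  ultimately have "\<forall>\<^sub>F (y, z) in nhds x \<times>\<^sub>F nhds x.
      norm (f y *\<^sub>R g y - f z *\<^sub>R g z) \<le> ((norm (f x) + 1) * K + L * (norm (g x) + 1)) * norm (y - z)"
    using L(2) K(2)
  proof eventually_elim
    case (elim p)
    obtain y z where p: "p = (y, z)" by fastforce
    \<comment> \<open>The splitting behind the product rule: it requires a bound on \<open>f\<close>
      at the first point and on \<open>g\<close> at the second.\<close>
    have "f y *\<^sub>R g y - f z *\<^sub>R g z = f y *\<^sub>R (g y - g z) + (f y - f z) *\<^sub>R g z"
      by (simp add: algebra_simps)
    also have "norm \<dots> \<le> norm (f y) * norm (g y - g z) + norm (f y - f z) * norm (g z)"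
      by (intro norm_triangle_le) simp
    also have "\<dots> \<le> (norm (f x) + 1) * (K * norm (y - z)) + (L * norm (y - z)) * (norm (g x) + 1)"
      using elim L(1) K(1) unfolding p by (intro add_mono mult_mono) auto
    finally show ?case unfolding p by (simp add: algebra_simps)
  qed
  then show ?thesis
    unfolding lipschitz_near_def by blast
qed

lemma lipschitz_near_mult:
  fixes f g :: "'a::real_normed_vector \<Rightarrow> real"
  shows "lipschitz_near f x \<Longrightarrow> lipschitz_near g x \<Longrightarrow> lipschitz_near (\<lambda>y. f y * g y) x"
  using lipschitz_near_scaleR[of f x g] by simp

lemma lipschitz_near_minus:
  "lipschitz_near f x \<Longrightarrow> lipschitz_near (\<lambda>y. - f y) x"
  by (rule lipschitz_near_compose[OF _ lipschitz_near_bounded_linear])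
    (auto intro: bounded_linear_minus bounded_linear_ident)

lemma lipschitz_near_diff:
  "lipschitz_near f x \<Longrightarrow> lipschitz_near g x \<Longrightarrow> lipschitz_near (\<lambda>y. f y - g y) x"
  using lipschitz_near_add[OF _ lipschitz_near_minus, of f x g] by simp

lemma lipschitz_near_sum:
  "(\<And>i. i \<in> I \<Longrightarrow> lipschitz_near (f i) x) \<Longrightarrow> lipschitz_near (\<lambda>y. \<Sum>i\<in>I. f i y) x"
  by (induction I rule: infinite_finite_induct)
    (auto intro: lipschitz_near_const lipschitz_near_add)

lemma lipschitz_near_vec_lambda:
  fixes f :: "'n::finite \<Rightarrow> 'a::real_normed_vector \<Rightarrow> real"
  assumes "\<And>i. lipschitz_near (f i) x"
  shows "lipschitz_near (\<lambda>y. \<chi> i. f i y) x"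
proof -
  have "(\<chi> i. f i y) = (\<Sum>i\<in>UNIV. f i y *\<^sub>R axis i 1)" for y
    using basis_expansion[of "\<chi> i. f i y"] by (simp add: scalar_mult_eq_scaleR)
  then show ?thesis
    by (simp add: assms lipschitz_near_sum lipschitz_near_scaleR lipschitz_near_const)
qed

lemma lipschitz_near_Pair:
  assumes "lipschitz_near f x" "lipschitz_near g x"
  shows "lipschitz_near (\<lambda>y. (f y, g y)) x"
proof -
  have "bounded_linear (\<lambda>u. (u, 0))" "bounded_linear (Pair 0)"
    by (auto intro: bounded_linear_Pair bounded_linear_ident bounded_linear_zero)
  then have "lipschitz_near (\<lambda>y. (f y, 0) + (0, g y)) x"
    by (intro lipschitz_near_add lipschitz_near_compose[OF assms(1)]
        lipschitz_near_compose[OF assms(2)] lipschitz_near_bounded_linear)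
  then show ?thesis by simp
qed

lemmas lipschitz_near_intros = lipschitz_near_const lipschitz_near_add lipschitz_near_diff
  lipschitz_near_minus lipschitz_near_mult lipschitz_near_sum lipschitz_near_vec_lambda
  lipschitz_near_Pair

text \<open>The derivatives in the finitely many basis directions are continuous, hence bounded near
  \<open>x\<close>. They bound the operator norm of the derivative on a ball, and the mean value
  inequality on this convex set gives the estimate.\<close>

lemma smooth_on_lipschitz_near:
  fixes f :: "'a::euclidean_space \<Rightarrow> 'b::real_normed_vector"
  assumes "open S" "smooth_on S f" "x \<in> S"
  shows "lipschitz_near f x"
proof -
  let ?D = "\<lambda>y. frechet_derivative f (at y)"
  have "\<forall>\<^sub>F y in nhds x. norm (?D y i) < norm (?D x i) + 1" for i
  proof -
    have "continuous_on S (\<lambda>y. ?D y i)"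
      by (intro smooth_on_continuous_on smooth_on_frechet_derivative assms)
    then have "isCont (\<lambda>y. ?D y i) x"
      using assms by (simp add: continuous_on_eq_continuous_at)
    then have "((\<lambda>y. ?D y i) \<longlongrightarrow> ?D x i) (nhds x)"
      unfolding isCont_def by (rule tendsto_at_iff_tendsto_nhds[THEN iffD1])
    from tendsto_norm[OF this] show ?thesis
      by (rule order_tendstoD) simp
  qed
  then have "\<forall>\<^sub>F y in nhds x. \<forall>i\<in>Basis. norm (?D y i) < norm (?D x i) + 1"
    by (intro eventually_ball_finite) auto
  then have "\<forall>\<^sub>F y in nhds x. y \<in> S \<and> (\<forall>i\<in>Basis. norm (?D y i) < norm (?D x i) + 1)"
    using eventually_nhds_in_open assms by (intro eventually_conj) auto
  then obtain d where d: "d > 0" "\<And>y. dist y x < d \<Longrightarrow> y \<in> S"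
    "\<And>y i. dist y x < d \<Longrightarrow> i \<in> Basis \<Longrightarrow> norm (?D y i) < norm (?D x i) + 1"
    unfolding eventually_nhds_metric by blast
  \<comment> \<open>Since each coordinate of \<open>h\<close> is at most \<open>norm h\<close>, the
    sum of the bounds in the basis directions dominates the operator norm.\<close>
  define L where "L = (\<Sum>i\<in>Basis. norm (?D x i) + 1)"
  have "norm (f y - f z) \<le> L * norm (y - z)" if "y \<in> ball x d" "z \<in> ball x d" for y z
  proof (rule differentiable_bound[OF convex_ball _ _ that])
    fix w assume "w \<in> ball x d"
    then have w: "dist w x < d" by (simp add: dist_commute)
    have Df: "(f has_derivative ?D w) (at w)"
      by (rule smooth_on_has_derivative[OF assms(2) d(2)[OF w]])
    then show "(f has_derivative ?D w) (at w within ball x d)"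
      by (rule has_derivative_at_withinI)
    interpret bounded_linear "?D w"
      using Df by (rule has_derivative_bounded_linear)
    show "onorm (?D w) \<le> L"
    proof (rule onorm_le)
      fix h
      have "?D w h = ?D w (\<Sum>i\<in>Basis. (h \<bullet> i) *\<^sub>R i)"
        by (simp add: euclidean_representation)
      also have "\<dots> = (\<Sum>i\<in>Basis. (h \<bullet> i) *\<^sub>R ?D w i)"
        by (simp add: sum scaleR)
      also have "norm \<dots> \<le> (\<Sum>i\<in>Basis. norm h * (norm (?D x i) + 1))"
      proof (rule sum_norm_le)
        fix i :: 'a assume i: "i \<in> Basis"
        show "norm ((h \<bullet> i) *\<^sub>R ?D w i) \<le> norm h * (norm (?D x i) + 1)"
          unfolding norm_scaleR real_norm_def
          by (intro mult_mono Basis_le_norm[OF i] less_imp_le[OF d(3)[OF w i]]) auto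
      qed
      finally show "norm (?D w h) \<le> L * norm h"
        by (simp add: L_def sum_distrib_left mult.commute)
    qed
  qed
  moreover have "\<forall>\<^sub>F p in nhds x \<times>\<^sub>F nhds x. p \<in> ball x d \<times> ball x d"
    unfolding nhds_prod[symmetric] using d(1) by (intro eventually_nhds_in_open open_Times) auto
  ultimately have "\<forall>\<^sub>F (y, z) in nhds x \<times>\<^sub>F nhds x. norm (f y - f z) \<le> L * norm (y - z)"
    by (auto elim!: eventually_mono)
  then show ?thesis
    unfolding lipschitz_near_def by blast
qed

section \<open>Gronwall's argument and uniqueness for autonomous differential equations\<close>

lemma gronwall_zero:
  fixes w :: "real \<Rightarrow> 'a::real_inner"
  assumes "w a = 0" "a \<le> b"
    and w: "\<And>t. a \<le> t \<Longrightarrow> t \<le> b \<Longrightarrow> (w has_vector_derivative w' t) (at t)"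
    and le: "\<And>t. a \<le> t \<Longrightarrow> t \<le> b \<Longrightarrow> norm (w' t) \<le> L * norm (w t)"
  shows "w b = 0"
proof -
  \<comment> \<open>The exponential is an integrating factor: by Cauchy-Schwarz the squared norm of
    \<open>w\<close> grows at rate at most \<open>2 * L\<close> times itself, so \<open>?g\<close>
    is nonincreasing. It starts at 0 and cannot become positive.\<close>
  let ?g = "\<lambda>t. exp (- 2 * L * t) * (w t \<bullet> w t)"
  have "?g b \<le> ?g a"
  proof (rule DERIV_nonpos_imp_nonincreasing[OF \<open>a \<le> b\<close>])
    fix t assume t: "a \<le> t" "t \<le> b"
    have "((\<lambda>t. w t \<bullet> w t) has_derivative (\<lambda>h. w t \<bullet> (h *\<^sub>R w' t) + (h *\<^sub>R w' t) \<bullet> w t)) (at t)"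
      using w[OF t] unfolding has_vector_derivative_def by (intro has_derivative_inner)
    then have "((\<lambda>t. w t \<bullet> w t) has_real_derivative 2 * (w t \<bullet> w' t)) (at t)"
      unfolding has_field_derivative_def
      by (rule has_derivative_eq_rhs) (auto simp: inner_commute)
    then have "(?g has_real_derivative
        exp (- 2 * L * t) * 2 * (w t \<bullet> w' t - L * (w t \<bullet> w t))) (at t)"
      by (auto intro!: derivative_eq_intros simp: algebra_simps)
    moreover have "w t \<bullet> w' t \<le> L * (w t \<bullet> w t)"
    proof -
      have "w t \<bullet> w' t \<le> norm (w t) * norm (w' t)" by (rule norm_cauchy_schwarz)
      also have "\<dots> \<le> norm (w t) * (L * norm (w t))"
        by (intro mult_left_mono le t) simp
      finally show ?thesis by (simp add: dot_square_norm power2_eq_square mult_ac)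
    qed
    then have "exp (- 2 * L * t) * 2 * (w t \<bullet> w' t - L * (w t \<bullet> w t)) \<le> 0"
      by (intro mult_nonneg_nonpos) auto
    ultimately show "\<exists>y. (?g has_real_derivative y) (at t) \<and> y \<le> 0"
      by blast
  qed
  then have "w b \<bullet> w b \<le> 0"
    using \<open>w a = 0\<close> by (simp add: mult_le_0_iff)
  then show ?thesis
    using inner_gt_zero_iff[of "w b"] by linarith
qed

text \<open>A connectedness argument: the set where the curves agree is closed in \<open>T\<close>
  by continuity, open by Gronwall, and contains \<open>t0\<close>, so it is all of the
  interval.\<close>

lemma integral_curve_unique:
  fixes X :: "'a::real_inner \<Rightarrow> 'a"
  assumes X: "\<And>q. q \<in> M \<Longrightarrow> lipschitz_near X q"
    and c: "integral_curve_on M X T c1" "integral_curve_on M X T c2"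
    and t0: "t0 \<in> T" "c1 t0 = c2 t0" and t: "t \<in> T"
  shows "c1 t = c2 t"
proof -
  define w where "w t = c1 t - c2 t" for t
  have T: "open T" "is_interval T"
    using c unfolding integral_curve_on_def by auto
  have dw: "(w has_vector_derivative X (c1 s) - X (c2 s)) (at s)" if "s \<in> T" for s
    using c that unfolding w_def[abs_def] integral_curve_on_def
    by (intro has_vector_derivative_diff) auto
  have "connected T" "continuous_on T w"
    using T dw by (auto simp: is_interval_connected_1 continuous_on_eq_continuous_at
        intro: has_vector_derivative_continuous)
  moreover have "openin (top_of_set T) {s \<in> T. w s = 0}"
  proof -
    have "open {s \<in> T. w s = 0}"
      unfolding open_dist
    proof
      fix s assume "s \<in> {s \<in> T. w s = 0}"
      then have s: "s \<in> T" "c2 s = c1 s" "w s = 0" by (auto simp: w_def)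
      have "c1 s \<in> M" using c s unfolding integral_curve_on_def by auto
      then obtain L where L: "L \<ge> 0"
        "\<forall>\<^sub>F (y, z) in nhds (c1 s) \<times>\<^sub>F nhds (c1 s). norm (X y - X z) \<le> L * norm (y - z)"
        using lipschitz_nearE[OF X] by blast
      have lim: "filterlim c (nhds (c s)) (nhds s)" if "integral_curve_on M X T c" for c
      proof -
        have "isCont c s"
          using that s unfolding integral_curve_on_def
          by (intro has_vector_derivative_continuous) auto
        then show ?thesis
          unfolding isCont_def by (rule tendsto_at_iff_tendsto_nhds[THEN iffD1])
      qed
      \<comment> \<open>Both curves pass through the same point at time \<open>s\<close>, so one
        Lipschitz constant governs the difference of their velocities near \<open>s\<close>.\<close>
      have "filterlim (\<lambda>t. (c1 t, c2 t)) (nhds (c1 s) \<times>\<^sub>F nhds (c1 s)) (nhds s)"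
        using lim[OF c(1)] lim[OF c(2)] unfolding s(2) by (rule filterlim_Pair)
      from eventually_compose_filterlim[OF L(2) this]
      have "\<forall>\<^sub>F t in nhds s. t \<in> T \<and> norm (X (c1 t) - X (c2 t)) \<le> L * norm (w t)"
        unfolding w_def using T(1) s(1) by (intro eventually_conj eventually_nhds_in_open) auto
      then obtain d where d: "d > 0"
        "\<And>t. dist t s < d \<Longrightarrow> t \<in> T \<and> norm (X (c1 t) - X (c2 t)) \<le> L * norm (w t)"
        unfolding eventually_nhds_metric by blast
      have "w t = 0" if "dist t s < d" for t
      proof (cases "s \<le> t")
        case True
        show ?thesis
          using that True by (intro gronwall_zero[OF s(3) True dw, of L])
            (use d(2) in \<open>auto simp: dist_real_def\<close>)
      next
        case False
        \<comment> \<open>Gronwall runs forward in time only; to the left of \<open>s\<close> it is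
          applied to the time-reversed difference on \<open>[-s, -t]\<close>.\<close>
        have "((\<lambda>r. w (- r)) has_vector_derivative - (X (c1 (- r)) - X (c2 (- r)))) (at r)"
          if "- r \<in> T" for r
        proof -
          have "(uminus has_vector_derivative (- 1 :: real)) (at r)"
            by (auto intro!: derivative_eq_intros)
          from vector_diff_chain_at[OF this dw[OF that]] show ?thesis
            by (simp add: o_def)
        qed
        moreover have "- r \<in> T" "norm (- (X (c1 (- r)) - X (c2 (- r)))) \<le> L * norm (w (- r))"
          if "- s \<le> r" "r \<le> - t" for r
        proof -
          have "dist (- r) s < d"
            using that False \<open>dist t s < d\<close> by (simp add: dist_real_def)
          from d(2)[OF this] show "- r \<in> T"
            "norm (- (X (c1 (- r)) - X (c2 (- r)))) \<le> L * norm (w (- r))"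
            by (auto simp only: norm_minus_cancel)
        qed
        ultimately have "w (- (- t)) = 0"
          using False s(3) by (intro gronwall_zero[of "\<lambda>r. w (- r)" "- s" "- t"]) auto
        then show ?thesis by simp
      qed
      then show "\<exists>e>0. \<forall>y. dist y s < e \<longrightarrow> y \<in> {s \<in> T. w s = 0}"
        using d by blast
    qed
    then show ?thesis
      using T(1) by (simp add: openin_open_eq)
  qed
  ultimately have "\<forall>s\<in>T. w s = 0"
    by (rule continuous_levelset_openin) (use t0 in \<open>auto simp: w_def\<close>)
  then show ?thesis
    using t by (simp add: w_def)
qed

section \<open>Uniqueness of the values of a flow\<close>

lemma integral_curve_on_subset:
  "integral_curve_on M X T c \<Longrightarrow> open T' \<Longrightarrow> is_interval T' \<Longrightarrow> T' \<subseteq> T \<Longrightarrow>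
   integral_curve_on M X T' c"
  unfolding integral_curve_on_def by blast

text \<open>The two witnessing curves may live on different intervals. Both restrict to the
  intersection, again an open interval containing 0 and \<open>t\<close>, where uniqueness of
  integral curves applies.\<close>

lemma flow_reaches_unique:
  fixes X :: "'a::real_inner \<Rightarrow> 'a"
  assumes X: "\<And>q. q \<in> M \<Longrightarrow> lipschitz_near X q"
    and "flow_reaches M X t q y" "flow_reaches M X t q y'"
  shows "y = y'"
proof -
  obtain T c where c: "integral_curve_on M X T c" "0 \<in> T" "t \<in> T" "c 0 = q" "c t = y"
    using assms(2) unfolding flow_reaches_def by blast
  obtain T' c' where c': "integral_curve_on M X T' c'" "0 \<in> T'" "t \<in> T'" "c' 0 = q" "c' t = y'"
    using assms(3) unfolding flow_reaches_def by blast
  have "open (T \<inter> T')" "is_interval (T \<inter> T')"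
    using c(1) c'(1) unfolding integral_curve_on_def by (auto intro: is_interval_Int)
  then have "integral_curve_on M X (T \<inter> T') c" and "integral_curve_on M X (T \<inter> T') c'"
    by (rule integral_curve_on_subset[OF c(1)] integral_curve_on_subset[OF c'(1)]; simp)+
  from integral_curve_unique[OF X this, of 0 t] have "c t = c' t"
    using c c' by simp
  then show ?thesis
    using c c' by simp
qed

lemma flow_eqI:
  assumes "flow_reaches M X t q y" "\<And>y'. flow_reaches M X t q y' \<Longrightarrow> y' = y"
  shows "flow M X t q = y"
  unfolding flow_def using assms by (rule the_equality)


section \<open>Derivatives in coordinates\<close>

lemma has_derivative_vec_lambda:
  fixes f :: "'n::finite \<Rightarrow> 'a::real_normed_vector \<Rightarrow> real"
  assumes "\<And>i. (f i has_derivative f' i) (at x)"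
  shows "((\<lambda>y. \<chi> i. f i y) has_derivative (\<lambda>v. \<chi> i. f' i v)) (at x)"
proof -
  have expand: "(\<chi> i. g i) = (\<Sum>i\<in>UNIV. g i *\<^sub>R axis i 1)" for g :: "'n \<Rightarrow> real"
    using basis_expansion[of "\<chi> i. g i"] by (simp add: scalar_mult_eq_scaleR)
  show ?thesis
    unfolding expand by (intro has_derivative_sum has_derivative_scaleR_left assms)
qed

lemma has_vector_derivative_chain:
  assumes "(f has_derivative f') (at (c t))" "(c has_vector_derivative w) (at t)"
  shows "((\<lambda>s. f (c s)) has_vector_derivative f' w) (at t)"
  using vector_derivative_diff_chain_within[of c w t UNIV f f'] assms
  by (simp add: o_def has_derivative_at_withinI)

text \<open>Here \<open>x\<close> stays a vector, as in the base equation for \<open>F\<close>,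
  while \<open>p\<close> is split into components, because the equations for \<open>Delta\<close>
  are indexed by \<open>a\<close>.\<close>

lemma has_vector_derivative_cpt_iff:
  fixes c :: "real \<Rightarrow> 'n::finite cpt"
  shows "(c has_vector_derivative w) (at t) \<longleftrightarrow>
    ((\<lambda>s. x_of (c s)) has_vector_derivative x_of w) (at t) \<and>
    ((\<lambda>s. xlast_of (c s)) has_real_derivative xlast_of w) (at t) \<and>
    (\<forall>a. ((\<lambda>s. p_of (c s) $ a) has_real_derivative p_of w $ a) (at t)) \<and>
    ((\<lambda>s. plast_of (c s)) has_real_derivative plast_of w) (at t) \<and>
    ((\<lambda>s. z_of (c s)) has_real_derivative z_of w) (at t)" (is "_ \<longleftrightarrow> ?R")
proof
  assume c: "(c has_vector_derivative w) (at t)"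
  have "bounded_linear (\<lambda>q::'n cpt. p_of q $ a)" for a
    by (intro bounded_linear_compose[OF bounded_linear_vec_nth]
        bounded_linear_fst_comp bounded_linear_snd_comp bounded_linear_ident)
  then show ?R
    unfolding has_real_derivative_iff_has_vector_derivative
    by (intro conjI allI bounded_linear.has_vector_derivative[OF _ c]
        bounded_linear_fst_comp bounded_linear_snd_comp bounded_linear_ident)
next
  assume R: ?R
  have "((\<lambda>s. \<chi> a. p_of (c s) $ a) has_vector_derivative (\<chi> a. p_of w $ a)) (at t)"
  proof -
    have "((\<lambda>s. p_of (c s) $ a) has_derivative (\<lambda>h. h * p_of w $ a)) (at t)" for a
      using R unfolding has_field_derivative_def by (simp add: mult.commute[of _ "p_of w $ a"])
    from has_derivative_vec_lambda[OF this] show ?thesis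
      unfolding has_vector_derivative_def
      by (rule has_derivative_eq_rhs) (simp add: fun_eq_iff vec_eq_iff)
  qed
  with R have "((\<lambda>s. (x_of (c s), xlast_of (c s), p_of (c s), plast_of (c s), z_of (c s)))
      has_vector_derivative (x_of w, xlast_of w, p_of w, plast_of w, z_of w)) (at t)"
    unfolding has_real_derivative_iff_has_vector_derivative
    by (intro has_vector_derivative_Pair) simp_all
  then show "(c has_vector_derivative w) (at t)" by simp
qed

lemma has_derivative_compose_x_of:
  assumes "(f has_derivative f') (at (x_of q))"
  shows "((\<lambda>q. f (x_of q)) has_derivative (\<lambda>v. f' (x_of v))) (at q)"
  by (rule has_derivative_compose[OF has_derivative_fst[OF has_derivative_ident] assms])

lemma psi_tilde_has_derivative:
  assumes "smooth_on \<Omega> \<psi>" "x_of q \<in> \<Omega>"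
  shows "(psi_tilde \<psi> p0 has_derivative
    (\<lambda>v. (\<Sum>a\<in>UNIV. x_of v $ a * pd a \<psi> (x_of q)) + p0 * xlast_of v)) (at q)"
  unfolding psi_tilde_def[abs_def]
  by (intro has_derivative_add has_derivative_compose_x_of[OF smooth_on_has_derivative_pd[OF assms]]
      has_derivative_mult_right has_derivative_fst has_derivative_snd has_derivative_ident)

lemma Delta_0_has_derivative:
  assumes "smooth_on \<Omega> \<psi>" "x_of q \<in> \<Omega>"
  shows "(Delta_0 \<psi> p0 has_derivative
    (\<lambda>v. (\<Sum>a\<in>UNIV. x_of v $ a * pd a \<psi> (x_of q)) + p0 * xlast_of v - z_of v)) (at q)"
  unfolding Delta_0_def[abs_def]
  by (intro has_derivative_diff psi_tilde_has_derivative[OF assms]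
      has_derivative_snd has_derivative_ident)

lemma Delta_has_derivative:
  assumes "smooth_on \<Omega> \<psi>" "x_of q \<in> \<Omega>"
  shows "(Delta \<psi> p0 a has_derivative
    (\<lambda>v. plast_of v / p0 * pd a \<psi> (x_of q)
       + plast_of q / p0 * (\<Sum>b\<in>UNIV. x_of v $ b * pd b (pd a \<psi>) (x_of q)) - p_of v $ a)) (at q)"
proof -
  note pd_has_derivative = has_derivative_compose_x_of[OF
      smooth_on_has_derivative_pd[OF smooth_on_pd[OF assms(1), of a] assms(2)]]
  show ?thesis
    unfolding Delta_def[abs_def]
    by (auto intro!: derivative_eq_intros pd_has_derivative
        bounded_linear.has_derivative[OF bounded_linear_vec_nth] simp: divide_inverse)
qed

lemma h_tilde_has_derivative:
  assumes "open \<Omega>" "smooth_on \<Omega> \<psi>" "smooth_on \<Omega> F" "smooth_on J \<Gamma>"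
    "x_of q \<in> \<Omega>" "Delta_0 \<psi> p0 q \<in> J"
  shows "(h_tilde \<psi> p0 F \<Gamma> has_derivative (\<lambda>v.
    (\<Sum>a\<in>UNIV. Delta \<psi> p0 a q * (\<Sum>b\<in>UNIV. x_of v $ b * pd b (\<lambda>y. F y $ a) (x_of q))
      + (plast_of v / p0 * pd a \<psi> (x_of q)
        + plast_of q / p0 * (\<Sum>b\<in>UNIV. x_of v $ b * pd b (pd a \<psi>) (x_of q)) - p_of v $ a) * F (x_of q) $ a)
    + deriv \<Gamma> (Delta_0 \<psi> p0 q) *
      ((\<Sum>a\<in>UNIV. x_of v $ a * pd a \<psi> (x_of q)) + p0 * xlast_of v - z_of v))) (at q)"
proof -
  have 1: "((\<lambda>q. \<Gamma> (Delta_0 \<psi> p0 q)) has_derivative (\<lambda>v. deriv \<Gamma> (Delta_0 \<psi> p0 q) *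
      ((\<Sum>a\<in>UNIV. x_of v $ a * pd a \<psi> (x_of q)) + p0 * xlast_of v - z_of v))) (at q)"
    using smooth_on_deriv[OF assms(4,6)] unfolding has_field_derivative_def
    by (rule has_derivative_compose[OF Delta_0_has_derivative[OF assms(2,5)]])
  have 2: "((\<lambda>q. \<Sum>a\<in>UNIV. Delta \<psi> p0 a q * F (x_of q) $ a) has_derivative
    (\<lambda>v. \<Sum>a\<in>UNIV. Delta \<psi> p0 a q * (\<Sum>b\<in>UNIV. x_of v $ b * pd b (\<lambda>y. F y $ a) (x_of q))
      + (plast_of v / p0 * pd a \<psi> (x_of q)
        + plast_of q / p0 * (\<Sum>b\<in>UNIV. x_of v $ b * pd b (pd a \<psi>) (x_of q)) - p_of v $ a) * F (x_of q) $ a)) (at q)"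
    by (intro has_derivative_sum has_derivative_mult Delta_has_derivative[OF assms(2,5)]
        has_derivative_compose_x_of[of "\<lambda>y. F y $ _"]
        smooth_on_has_derivative_pd[OF smooth_on_nth[OF assms(1,3)] assms(5)])
  show ?thesis
    unfolding h_tilde_def[abs_def] by (rule has_derivative_add[OF 2 1])
qed


section \<open>The lifted vector field\<close>

lemma X_tilde_components:
  "x_of (X_tilde \<psi> p0 F \<Gamma> q) = F (x_of q)"
  "xlast_of (X_tilde \<psi> p0 F \<Gamma> q) = - (1 / p0) * (\<Sum>j\<in>UNIV. pd j \<psi> (x_of q) * F (x_of q) $ j)"
  "p_of (X_tilde \<psi> p0 F \<Gamma> q) $ a =
     plast_of q / p0 * (\<Sum>j\<in>UNIV. pd a (pd j \<psi>) (x_of q) * F (x_of q) $ j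
       + pd j \<psi> (x_of q) * pd a (\<lambda>y. F y $ j) (x_of q))
     - (\<Sum>j\<in>UNIV. p_of q $ j * pd a (\<lambda>y. F y $ j) (x_of q))
     + deriv \<Gamma> (Delta_0 \<psi> p0 q) * (pd a \<psi> (x_of q) - p_of q $ a)"
  "plast_of (X_tilde \<psi> p0 F \<Gamma> q) = deriv \<Gamma> (Delta_0 \<psi> p0 q) * (p0 - plast_of q)"
  "z_of (X_tilde \<psi> p0 F \<Gamma> q) = \<Gamma> (Delta_0 \<psi> p0 q)"
  by (simp_all add: X_tilde_def Let_def)

text \<open>The left side is the derivative of \<open>psi_tilde\<close> along the field; the
  velocity of the last position coordinate is chosen to cancel the contribution of \<open>F\<close>.
  This gives both the Lie derivative and the equation for \<open>Delta_0\<close>.\<close>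

lemma psi_tilde_along_X_tilde:
  assumes "p0 \<noteq> 0"
  shows "(\<Sum>a\<in>UNIV. F (x_of q) $ a * pd a \<psi> (x_of q)) + p0 * xlast_of (X_tilde \<psi> p0 F \<Gamma> q) = 0"
  using assms by (simp add: X_tilde_components mult.commute)

text \<open>The left side is the derivative of \<open>Delta\<close> along the field. The Hessian
  terms cancel by symmetry of second derivatives; the remaining terms group into multiples of
  \<open>Delta\<close>, those with derivatives of \<open>F\<close> and those with
  \<open>deriv \<Gamma>\<close> separately.\<close>

lemma Delta_along_X_tilde:
  assumes "p0 \<noteq> 0" "open \<Omega>" "smooth_on \<Omega> \<psi>" "x_of q \<in> \<Omega>"
  shows "plast_of (X_tilde \<psi> p0 F \<Gamma> q) / p0 * pd a \<psi> (x_of q)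
      + plast_of q / p0 * (\<Sum>b\<in>UNIV. F (x_of q) $ b * pd b (pd a \<psi>) (x_of q))
      - p_of (X_tilde \<psi> p0 F \<Gamma> q) $ a =
    - (\<Sum>j\<in>UNIV. pd a (\<lambda>y. F y $ j) (x_of q) * Delta \<psi> p0 j q)
    - deriv \<Gamma> (Delta_0 \<psi> p0 q) * Delta \<psi> p0 a q"
proof -
  \<comment> \<open>With the ratio \<open>k\<close> as a variable, \<open>r\<close> removes the
    division by \<open>p0\<close> and the claim becomes a polynomial identity.\<close>
  define k where "k = plast_of q / p0"
  have r: "deriv \<Gamma> (Delta_0 \<psi> p0 q) * (p0 - plast_of q) / p0 = deriv \<Gamma> (Delta_0 \<psi> p0 q) * (1 - k)"
    using assms(1) by (simp add: k_def field_simps)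
  have "pd b (pd a \<psi>) (x_of q) = pd a (pd b \<psi>) (x_of q)" for b
    by (rule pd_commute[OF assms(2-4)])
  then show ?thesis
    unfolding X_tilde_components Delta_def r k_def[symmetric]
    by (simp add: algebra_simps sum.distrib sum_subtractf sum_distrib_left)
qed

text \<open>Each component is built by sums and products from coordinates, smooth functions of
  \<open>x\<close>, and \<Gamma> or its derivative at \<open>Delta_0\<close>. This supplies
  uniqueness for the lifted flow.\<close>

lemma X_tilde_lipschitz_near:
  assumes "open \<Omega>" "smooth_on \<Omega> \<psi>" "smooth_on \<Omega> F" "open J" "smooth_on J \<Gamma>"
    "x_of q \<in> \<Omega>" "Delta_0 \<psi> p0 q \<in> J"
  shows "lipschitz_near (X_tilde \<psi> p0 F \<Gamma>) q"
proof -
  have base: "lipschitz_near (\<lambda>q. f (x_of q)) q" if "smooth_on \<Omega> f"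
    for f :: "_ \<Rightarrow> 'b::real_normed_vector"
    by (intro lipschitz_near_compose[of x_of q f] lipschitz_near_bounded_linear bounded_linear_fst
        smooth_on_lipschitz_near[OF assms(1) that assms(6)])
  note lin = bounded_linear_fst_comp bounded_linear_snd_comp bounded_linear_ident
  have coords: "lipschitz_near (\<lambda>q::'a cpt. xlast_of q) q" "lipschitz_near (\<lambda>q::'a cpt. p_of q $ a) q"
    "lipschitz_near (\<lambda>q::'a cpt. plast_of q / p0) q" "lipschitz_near (\<lambda>q::'a cpt. plast_of q) q"
    "lipschitz_near (\<lambda>q::'a cpt. z_of q) q" for a
    unfolding divide_inverse
    by (intro lipschitz_near_bounded_linear lin bounded_linear_mult_const
        bounded_linear_compose[OF bounded_linear_vec_nth])+
  have D0: "lipschitz_near (\<lambda>q. Delta_0 \<psi> p0 q) q"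
    unfolding Delta_0_def psi_tilde_def by (intro lipschitz_near_intros base assms(2) coords)
  have "lipschitz_near (deriv \<Gamma>) (Delta_0 \<psi> p0 q)"
  proof (rule lipschitz_near_cong[OF assms(4,7)])
    show "frechet_derivative \<Gamma> (at y) 1 = deriv \<Gamma> y" if "y \<in> J" for y
      using frechet_derivative_at[OF smooth_on_deriv[OF assms(5) that, unfolded
            has_field_derivative_def], THEN fun_cong, of 1] by simp
    show "lipschitz_near (\<lambda>y. frechet_derivative \<Gamma> (at y) 1) (Delta_0 \<psi> p0 q)"
      by (intro smooth_on_lipschitz_near[OF assms(4) _ assms(7)]
          smooth_on_frechet_derivative assms(5))
  qed
  then have G': "lipschitz_near (\<lambda>q. deriv \<Gamma> (Delta_0 \<psi> p0 q)) q"
    by (rule lipschitz_near_compose[OF D0])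
  have G: "lipschitz_near (\<lambda>q. \<Gamma> (Delta_0 \<psi> p0 q)) q"
    by (rule lipschitz_near_compose[OF D0 smooth_on_lipschitz_near[OF assms(4,5,7)]])
  note F_nth = smooth_on_nth[OF assms(1,3)]
  note funs = base[OF assms(3)] base[OF F_nth] base[OF smooth_on_pd[OF F_nth]]
    base[OF smooth_on_pd[OF assms(2)]] base[OF smooth_on_pd[OF smooth_on_pd[OF assms(2)]]]
  show ?thesis
    unfolding X_tilde_def[abs_def] Let_def
    by (intro lipschitz_near_intros coords G G' funs)
qed

lemma X_tilde_contact_hamiltonian:
  assumes "open \<Omega>" "smooth_on \<Omega> \<psi>" "smooth_on \<Omega> F" "smooth_on J \<Gamma>"
    "x_of ` U \<subseteq> \<Omega>" "Delta_0 \<psi> p0 ` U \<subseteq> J"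
  shows "is_contact_hamiltonian_field U (h_tilde \<psi> p0 F \<Gamma>) (X_tilde \<psi> p0 F \<Gamma>)"
  unfolding is_contact_hamiltonian_field_def
proof (intro ballI conjI allI)
  fix q v assume "q \<in> U"
  then have q: "x_of q \<in> \<Omega>" "Delta_0 \<psi> p0 q \<in> J" using assms by auto
  let ?x = "x_of q" and ?G = "deriv \<Gamma> (Delta_0 \<psi> p0 q)"
  define k where "k = plast_of q / p0"
  \<comment> \<open>The velocity of the last position coordinate, weighted by
    \<open>- plast_of q\<close>, produces the \<psi>-part of \<open>Delta\<close>; the velocity of
    \<open>z\<close> produces the \<Gamma> term.\<close>
  show "contact_form q (X_tilde \<psi> p0 F \<Gamma> q) = h_tilde \<psi> p0 F \<Gamma> q"
    unfolding contact_form_def h_tilde_def Delta_def X_tilde_components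
    by (simp add: algebra_simps sum_subtractf sum_distrib_left sum_negf)
  note dh = frechet_derivative_at[OF h_tilde_has_derivative[OF assms(1-4) q], symmetric]
  \<comment> \<open>The Hamiltonian depends on \<open>z\<close> only through \<open>Delta_0\<close>,
    whose derivative in \<open>z\<close> is -1.\<close>
  have dz: "d_dz (h_tilde \<psi> p0 F \<Gamma>) q = - ?G"
    unfolding d_dz_def dh by simp
  \<comment> \<open>Pairing the velocity of \<open>p\<close> with the \<open>x\<close>-part of
    \<open>v\<close> and interchanging the two sums regroups it into directional derivatives of
    \<open>pd a \<psi>\<close> and of the components of \<open>F\<close>, the form in which they
    occur in the differential of the Hamiltonian.\<close>
  have p: "(\<Sum>a\<in>UNIV. p_of (X_tilde \<psi> p0 F \<Gamma> q) $ a * x_of v $ a) =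
    (\<Sum>a\<in>UNIV. k * (\<Sum>b\<in>UNIV. x_of v $ b * pd b (pd a \<psi>) ?x) * F ?x $ a
      + Delta \<psi> p0 a q * (\<Sum>b\<in>UNIV. x_of v $ b * pd b (\<lambda>y. F y $ a) ?x))
    + ?G * ((\<Sum>a\<in>UNIV. x_of v $ a * pd a \<psi> ?x) - (\<Sum>a\<in>UNIV. p_of q $ a * x_of v $ a))"
  proof -
    have "p_of (X_tilde \<psi> p0 F \<Gamma> q) $ a =
      (\<Sum>b\<in>UNIV. k * pd a (pd b \<psi>) ?x * F ?x $ b + Delta \<psi> p0 b q * pd a (\<lambda>y. F y $ b) ?x)
      + ?G * (pd a \<psi> ?x - p_of q $ a)" for a
      unfolding X_tilde_components Delta_def k_def[symmetric]
      by (simp add: algebra_simps sum.distrib sum_subtractf sum_distrib_left)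
    moreover have "(\<Sum>a\<in>UNIV. (\<Sum>b\<in>UNIV. k * pd a (pd b \<psi>) ?x * F ?x $ b
        + Delta \<psi> p0 b q * pd a (\<lambda>y. F y $ b) ?x) * x_of v $ a) =
      (\<Sum>b\<in>UNIV. k * (\<Sum>a\<in>UNIV. x_of v $ a * pd a (pd b \<psi>) ?x) * F ?x $ b
        + Delta \<psi> p0 b q * (\<Sum>a\<in>UNIV. x_of v $ a * pd a (\<lambda>y. F y $ b) ?x))"
      unfolding sum_distrib_right
      by (subst sum.swap) (simp add: algebra_simps sum.distrib sum_distrib_left)
    moreover have "(\<Sum>a\<in>UNIV. ?G * (pd a \<psi> ?x - p_of q $ a) * x_of v $ a) =
      ?G * ((\<Sum>a\<in>UNIV. x_of v $ a * pd a \<psi> ?x) - (\<Sum>a\<in>UNIV. p_of q $ a * x_of v $ a))"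
      by (simp add: algebra_simps sum_subtractf sum_distrib_left)
    ultimately show ?thesis
      by (simp add: distrib_right sum.distrib)
  qed
  define m where "m = plast_of v / p0"
  \<comment> \<open>Sorted by the components of \<open>v\<close>, to be matched with the exterior
    derivative. The \<open>z\<close>-component carries \<open>- ?G\<close> and is cancelled by the
    \<open>dz\<close> of the contact form.\<close>
  have "frechet_derivative (h_tilde \<psi> p0 F \<Gamma>) (at q) v =
    m * (\<Sum>a\<in>UNIV. pd a \<psi> ?x * F ?x $ a) - (\<Sum>a\<in>UNIV. F ?x $ a * p_of v $ a)
    + (\<Sum>a\<in>UNIV. k * (\<Sum>b\<in>UNIV. x_of v $ b * pd b (pd a \<psi>) ?x) * F ?x $ a
      + Delta \<psi> p0 a q * (\<Sum>b\<in>UNIV. x_of v $ b * pd b (\<lambda>y. F y $ a) ?x))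
    + ?G * ((\<Sum>a\<in>UNIV. x_of v $ a * pd a \<psi> ?x) + p0 * xlast_of v - z_of v)"
    unfolding dh k_def[symmetric] m_def[symmetric]
    by (simp add: algebra_simps sum.distrib sum_subtractf sum_distrib_left)
  then show "ext_deriv contact_form q (X_tilde \<psi> p0 F \<Gamma> q) v =
    - (frechet_derivative (h_tilde \<psi> p0 F \<Gamma>) (at q) v
       - d_dz (h_tilde \<psi> p0 F \<Gamma>) q * contact_form q v)"
    unfolding ext_deriv_contact_form dz contact_form_def sum_subtractf p X_tilde_components(1,2,4) m_def
    by (simp add: algebra_simps)
qed

section \<open>The equations of motion in the variables \<open>Delta\<close> and
  \<open>Delta_0\<close>\<close>

lemma Delta_has_real_derivative_iff:
  assumes "p0 \<noteq> 0" "open \<Omega>" "smooth_on \<Omega> \<psi>" "x_of (c t) \<in> \<Omega>"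
    and x: "((\<lambda>s. x_of (c s)) has_vector_derivative F (x_of (c t))) (at t)"
    and r: "((\<lambda>s. plast_of (c s)) has_real_derivative
        plast_of (X_tilde \<psi> p0 F \<Gamma> (c t))) (at t)"
  shows "((\<lambda>s. p_of (c s) $ a) has_real_derivative p_of (X_tilde \<psi> p0 F \<Gamma> (c t)) $ a) (at t) \<longleftrightarrow>
    ((\<lambda>s. Delta \<psi> p0 a (c s)) has_real_derivative
      - (\<Sum>j\<in>UNIV. pd a (\<lambda>y. F y $ j) (x_of (c t)) * Delta \<psi> p0 j (c t))
      - deriv \<Gamma> (Delta_0 \<psi> p0 (c t)) * Delta \<psi> p0 a (c t)) (at t)" (is "?p \<longleftrightarrow> ?D")
proof -
  let ?X = "X_tilde \<psi> p0 F \<Gamma> (c t)"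
  let ?g = "\<lambda>s. plast_of (c s) / p0 * pd a \<psi> (x_of (c s))"
  have "((\<lambda>s. pd a \<psi> (x_of (c s))) has_real_derivative
      (\<Sum>b\<in>UNIV. F (x_of (c t)) $ b * pd b (pd a \<psi>) (x_of (c t)))) (at t)"
    unfolding has_real_derivative_iff_has_vector_derivative
    by (rule has_vector_derivative_chain[OF
          smooth_on_has_derivative_pd[OF smooth_on_pd[OF assms(3)] assms(4)] x])
  from DERIV_mult[OF DERIV_cdivide[OF r] this]
  have g: "(?g has_real_derivative plast_of ?X / p0 * pd a \<psi> (x_of (c t))
      + plast_of (c t) / p0 * (\<Sum>b\<in>UNIV. F (x_of (c t)) $ b * pd b (pd a \<psi>) (x_of (c t)))) (at t)"
    by (simp only: mult.commute)
  \<comment> \<open>Each of \<open>Delta\<close> and the component of \<open>p\<close> is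
    \<open>?g\<close> minus the other, and the derivative of \<open>?g\<close> is fixed by the
    equations for \<open>x\<close> and \<open>plast_of\<close>. Hence differentiability and the
    derivative transfer both ways.\<close>
  have eq: "(\<lambda>s. Delta \<psi> p0 a (c s)) = (\<lambda>s. ?g s - p_of (c s) $ a)"
    "(\<lambda>s. p_of (c s) $ a) = (\<lambda>s. ?g s - Delta \<psi> p0 a (c s))"
    by (simp_all add: Delta_def)
  show ?thesis
  proof
    assume ?p
    from DERIV_diff[OF g this] show ?D
      unfolding eq(1) Delta_along_X_tilde[OF assms(1-4), symmetric] .
  next
    assume ?D
    from DERIV_diff[OF g this] show ?p
      unfolding Delta_along_X_tilde[OF assms(1-4), symmetric] eq(2) by simp
  qed
qed

text \<open>Along such a curve \<open>psi_tilde\<close> has derivative 0, so \<open>z\<close> and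
  \<open>Delta_0\<close> have opposite derivatives.\<close>

lemma Delta_0_has_real_derivative_iff:
  assumes "p0 \<noteq> 0" "smooth_on \<Omega> \<psi>" "x_of (c t) \<in> \<Omega>"
    and x: "((\<lambda>s. x_of (c s)) has_vector_derivative F (x_of (c t))) (at t)"
    and u: "((\<lambda>s. xlast_of (c s)) has_real_derivative
        xlast_of (X_tilde \<psi> p0 F \<Gamma> (c t))) (at t)"
  shows "((\<lambda>s. z_of (c s)) has_real_derivative z_of (X_tilde \<psi> p0 F \<Gamma> (c t))) (at t) \<longleftrightarrow>
    ((\<lambda>s. Delta_0 \<psi> p0 (c s)) has_real_derivative - \<Gamma> (Delta_0 \<psi> p0 (c t))) (at t)"
    (is "?z \<longleftrightarrow> ?D")
proof -
  let ?g = "\<lambda>s. \<psi> (x_of (c s)) + p0 * xlast_of (c s)"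
  have "((\<lambda>s. \<psi> (x_of (c s))) has_real_derivative
      (\<Sum>b\<in>UNIV. F (x_of (c t)) $ b * pd b \<psi> (x_of (c t)))) (at t)"
    unfolding has_real_derivative_iff_has_vector_derivative
    by (rule has_vector_derivative_chain[OF smooth_on_has_derivative_pd[OF assms(2,3)] x])
  from DERIV_add[OF this DERIV_cmult[OF u, of p0]]
  have g: "(?g has_real_derivative 0) (at t)"
    unfolding psi_tilde_along_X_tilde[OF assms(1)] .
  have eq: "(\<lambda>s. Delta_0 \<psi> p0 (c s)) = (\<lambda>s. ?g s - z_of (c s))"
    "(\<lambda>s. z_of (c s)) = (\<lambda>s. ?g s - Delta_0 \<psi> p0 (c s))"
    by (simp_all add: Delta_0_def psi_tilde_def)
  show ?thesis
  proof
    assume ?z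
    from DERIV_diff[OF g this] show ?D
      unfolding eq(1) X_tilde_components(5) by simp
  next
    assume ?D
    from DERIV_diff[OF g this] show ?z
      unfolding eq(2) X_tilde_components(5) by simp
  qed
qed

text \<open>Exchanging \<open>p\<close> for \<open>Delta\<close> presupposes the equations for
  \<open>x\<close> and \<open>plast_of\<close>, and exchanging \<open>z\<close> for
  \<open>Delta_0\<close> those for \<open>x\<close> and \<open>xlast_of\<close>. These three stand
  on both sides, so \<open>conj_cong5\<close> may assume them.\<close>

lemma X_tilde_integral_curve_iff:
  assumes "p0 \<noteq> 0" "open \<Omega>" "smooth_on \<Omega> \<psi>" "x_of (c t) \<in> \<Omega>"
  shows "(c has_vector_derivative X_tilde \<psi> p0 F \<Gamma> (c t)) (at t) \<longleftrightarrow>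
     ((\<lambda>s. x_of (c s)) has_vector_derivative F (x_of (c t))) (at t) \<and>
     ((\<lambda>s. xlast_of (c s)) has_real_derivative
        - (1 / p0) * (\<Sum>j\<in>UNIV. pd j \<psi> (x_of (c t)) * F (x_of (c t)) $ j)) (at t) \<and>
     ((\<lambda>s. plast_of (c s)) has_real_derivative
        deriv \<Gamma> (Delta_0 \<psi> p0 (c t)) * (p0 - plast_of (c t))) (at t) \<and>
     (\<forall>a. ((\<lambda>s. Delta \<psi> p0 a (c s)) has_real_derivative
        - (\<Sum>j\<in>UNIV. pd a (\<lambda>y. F y $ j) (x_of (c t)) * Delta \<psi> p0 j (c t))
        - deriv \<Gamma> (Delta_0 \<psi> p0 (c t)) * Delta \<psi> p0 a (c t)) (at t)) \<and>
     ((\<lambda>s. Delta_0 \<psi> p0 (c s)) has_real_derivative - \<Gamma> (Delta_0 \<psi> p0 (c t))) (at t)"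
proof -
  have conj_cong5: "A \<and> B \<and> (\<forall>a. P a) \<and> R \<and> Z \<longleftrightarrow> A \<and> B \<and> R \<and> (\<forall>a. D a) \<and> D0"
    if "\<And>a. A \<Longrightarrow> R \<Longrightarrow> P a \<longleftrightarrow> D a" "A \<Longrightarrow> B \<Longrightarrow> Z \<longleftrightarrow> D0"
    for A B R Z D0 :: bool and P D :: "'a \<Rightarrow> bool"
    using that by blast
  show ?thesis
    unfolding has_vector_derivative_cpt_iff X_tilde_components(1,2,4)
    by (rule conj_cong5;
        rule Delta_has_real_derivative_iff[of p0 \<Omega> \<psi> c t, OF assms, unfolded X_tilde_components(4)]
             Delta_0_has_real_derivative_iff[of p0 \<Omega> \<psi> c t, OF assms(1,3,4), unfolded X_tilde_components(2)])
qed


section \<open>Flows on the Legendre submanifold\<close>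

lemma legendre_map_has_derivative:
  assumes "smooth_on \<Omega> \<psi>" "x \<in> \<Omega>"
  shows "(legendre_map \<psi> has_derivative (\<lambda>v. (v, (\<chi> a. frechet_derivative (pd a \<psi>) (at x) v),
    frechet_derivative \<psi> (at x) v))) (at x)"
  unfolding legendre_map_def[abs_def]
  by (intro has_derivative_Pair has_derivative_ident has_derivative_vec_lambda
      smooth_on_has_derivative[OF _ assms(2)] smooth_on_pd assms(1))

lemma fst_legendre_map: "fst (legendre_map \<psi> x) = x"
  by (simp add: legendre_map_def)

text \<open>The first projection inverts the parametrization and sends the pushed-forward field back
  to \<open>F\<close>, so integral curves on the submanifold and in \<Omega> correspond. Flow
  questions on the submanifold thus reduce to \<Omega>.\<close>

lemma flow_reaches_legendre_iff:
  assumes "smooth_on \<Omega> \<psi>"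
  shows "flow_reaches (legendre_submanifold \<Omega> \<psi>) (legendre_field \<psi> F) t (legendre_map \<psi> x) y \<longleftrightarrow>
    (\<exists>x'. y = legendre_map \<psi> x' \<and> flow_reaches \<Omega> F t x x')"
proof
  assume "flow_reaches (legendre_submanifold \<Omega> \<psi>) (legendre_field \<psi> F) t (legendre_map \<psi> x) y"
  then obtain T c where c: "integral_curve_on (legendre_submanifold \<Omega> \<psi>) (legendre_field \<psi> F) T c"
    "0 \<in> T" "t \<in> T" "c 0 = legendre_map \<psi> x" "c t = y"
    unfolding flow_reaches_def by blast
  \<comment> \<open>A point of the submanifold is recovered from its \<open>x\<close>-part, so the
    projected curve loses no information.\<close>
  have on: "fst (c s) \<in> \<Omega> \<and> c s = legendre_map \<psi> (fst (c s))" if "s \<in> T" for s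
    using c(1) that unfolding integral_curve_on_def legendre_submanifold_def
    by (auto simp: fst_legendre_map)
  have "((\<lambda>s. fst (c s)) has_vector_derivative F (fst (c s))) (at s)" if "s \<in> T" for s
  proof -
    have "fst (legendre_field \<psi> F (c s)) = F (fst (c s))"
      unfolding legendre_field_def frechet_derivative_at[OF
          legendre_map_has_derivative[OF assms conjunct1[OF on[OF that]]], symmetric]
      by simp
    moreover have "(c has_vector_derivative legendre_field \<psi> F (c s)) (at s)"
      using c(1) that unfolding integral_curve_on_def by blast
    from bounded_linear.has_vector_derivative[OF bounded_linear_fst this]
    have "((\<lambda>s. fst (c s)) has_vector_derivative fst (legendre_field \<psi> F (c s))) (at s)" .
    ultimately show ?thesis
      by simp
  qed
  then have "integral_curve_on \<Omega> F T (\<lambda>s. fst (c s))"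
    using c(1) on unfolding integral_curve_on_def by blast
  then have "flow_reaches \<Omega> F t x (fst y)"
    using c fst_legendre_map unfolding flow_reaches_def by (intro exI[of _ T] exI[of _ "\<lambda>s. fst (c s)"]) simp
  then show "\<exists>x'. y = legendre_map \<psi> x' \<and> flow_reaches \<Omega> F t x x'"
    using on[OF c(3)] c(5) by blast
next
  assume "\<exists>x'. y = legendre_map \<psi> x' \<and> flow_reaches \<Omega> F t x x'"
  then obtain T c where c: "integral_curve_on \<Omega> F T c" "0 \<in> T" "t \<in> T" "c 0 = x"
    "y = legendre_map \<psi> (c t)"
    unfolding flow_reaches_def by blast
  have "((\<lambda>s. legendre_map \<psi> (c s)) has_vector_derivative
      legendre_field \<psi> F (legendre_map \<psi> (c s))) (at s)" if "s \<in> T" for s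
  proof -
    have s: "c s \<in> \<Omega>" "(c has_vector_derivative F (c s)) (at s)"
      using c(1) that unfolding integral_curve_on_def by blast+
    have "legendre_map \<psi> differentiable (at (c s))"
      using legendre_map_has_derivative[OF assms s(1)] unfolding differentiable_def by blast
    then show ?thesis
      unfolding legendre_field_def fst_legendre_map frechet_derivative_works
      by (rule has_vector_derivative_chain[OF _ s(2)])
  qed
  then have "integral_curve_on (legendre_submanifold \<Omega> \<psi>) (legendre_field \<psi> F) T
      (\<lambda>s. legendre_map \<psi> (c s))"
    using c(1) unfolding integral_curve_on_def legendre_submanifold_def by blast
  then show "flow_reaches (legendre_submanifold \<Omega> \<psi>) (legendre_field \<psi> F) t (legendre_map \<psi> x) y"
    using c unfolding flow_reaches_def
    by (intro exI[of _ T] exI[of _ "\<lambda>s. legendre_map \<psi> (c s)"]) simp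
qed

text \<open>Since \<open>P\<close> maps \<open>X\<close> to \<open>F\<close>, it maps integral
  curves to integral curves, which gives the inclusion of flow domains. Uniqueness upstairs and on
  the base makes both definite descriptions denote, and so yields equality of the flows.\<close>

lemma is_flow_lift_legendre:
  fixes X :: "'b::real_inner \<Rightarrow> 'b" and F :: "real^'n::finite \<Rightarrow> real^'n"
  assumes "open \<Omega>" "smooth_on \<Omega> \<psi>" "smooth_on \<Omega> F"
    and P: "bounded_linear P" "P ` U \<subseteq> \<Omega>" "\<And>q. q \<in> U \<Longrightarrow> P (X q) = F (P q)"
    and X: "\<And>q. q \<in> U \<Longrightarrow> lipschitz_near X q"
  shows "is_flow_lift U X (legendre_submanifold \<Omega> \<psi>) (legendre_field \<psi> F) (\<lambda>q. legendre_map \<psi> (P q))"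
  unfolding is_flow_lift_def
proof (intro conjI ballI)
  show "(\<lambda>q. legendre_map \<psi> (P q)) ` U \<subseteq> legendre_submanifold \<Omega> \<psi>"
    using P(2) unfolding legendre_submanifold_def by auto
next
  let ?flow = "flow (legendre_submanifold \<Omega> \<psi>) (legendre_field \<psi> F)"
  let ?dom = "flow_domain (legendre_submanifold \<Omega> \<psi>) (legendre_field \<psi> F)"
  have main: "(t, legendre_map \<psi> (P q)) \<in> ?dom \<and>
      legendre_map \<psi> (P (flow U X t q)) = ?flow t (legendre_map \<psi> (P q))"
    if dom: "(t, q) \<in> flow_domain U X" for t q
  proof -
    obtain y where y: "flow_reaches U X t q y"
      using dom unfolding flow_domain_def by blast
    then obtain T c where c: "integral_curve_on U X T c" "0 \<in> T" "t \<in> T" "c 0 = q" "c t = y"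
      unfolding flow_reaches_def by blast
    have "((\<lambda>s. P (c s)) has_vector_derivative F (P (c s))) (at s)" if "s \<in> T" for s
    proof -
      have s: "c s \<in> U" "(c has_vector_derivative X (c s)) (at s)"
        using c(1) that unfolding integral_curve_on_def by blast+
      from bounded_linear.has_vector_derivative[OF P(1) s(2)] P(3)[OF s(1)] show ?thesis
        by simp
    qed
    then have "integral_curve_on \<Omega> F T (\<lambda>s. P (c s))"
      using c(1) P(2) unfolding integral_curve_on_def by blast
    then have base: "flow_reaches \<Omega> F t (P q) (P y)"
      using c unfolding flow_reaches_def by (intro exI[of _ T] exI[of _ "\<lambda>s. P (c s)"]) simp
    have up: "flow U X t q = y"
      by (rule flow_eqI[OF y]) (rule flow_reaches_unique[OF X _ y])
    have reach: "flow_reaches (legendre_submanifold \<Omega> \<psi>) (legendre_field \<psi> F) t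
        (legendre_map \<psi> (P q)) (legendre_map \<psi> (P y))"
      unfolding flow_reaches_legendre_iff[OF assms(2)] using base by blast
    have down: "?flow t (legendre_map \<psi> (P q)) = legendre_map \<psi> (P y)"
    proof (rule flow_eqI[OF reach])
      fix y' assume "flow_reaches (legendre_submanifold \<Omega> \<psi>) (legendre_field \<psi> F) t
        (legendre_map \<psi> (P q)) y'"
      then obtain x' where x': "y' = legendre_map \<psi> x'" "flow_reaches \<Omega> F t (P q) x'"
        unfolding flow_reaches_legendre_iff[OF assms(2)] by blast
      \<comment> \<open>Uniqueness is transported from \<Omega>, where \<open>F\<close> is smooth on
        an open set and hence locally Lipschitz.\<close>
      have "x' = P y"
        by (rule flow_reaches_unique[OF smooth_on_lipschitz_near[OF assms(1,3)] x'(2) base])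
      then show "y' = legendre_map \<psi> (P y)" using x'(1) by simp
    qed
    have "(t, legendre_map \<psi> (P q)) \<in> ?dom"
      using reach unfolding flow_domain_def mem_Collect_eq prod.case by (rule exI)
    then show ?thesis
      unfolding up down by simp
  qed
  show "case u of (t, q) \<Rightarrow> (t, legendre_map \<psi> (P q)) \<in> ?dom \<and>
      legendre_map \<psi> (P (flow U X t q)) = ?flow t (legendre_map \<psi> (P q))"
    if "u \<in> flow_domain U X" for u
    using main that by (cases u) simp
qed

text \<open>The objects are local: \<open>U\<close> is a coordinate domain whose points have
  \<open>x\<close> in \<Omega> and \<open>Delta_0\<close> in \<open>J\<close>. The projection is
  \<open>x_of\<close> followed by the parametrization of the submanifold. Equivalence of the two
  systems is expressed by their having the same solution curves in \<open>U\<close>.\<close>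

theorem proposition5p2:
  fixes U :: "'n::finite cpt set"
    and \<Omega> :: "(real^'n) set"
    and J :: "real set"
    and \<psi> :: "real^'n \<Rightarrow> real"
    and p0 :: real
    and F :: "real^'n \<Rightarrow> real^'n"
    and \<Gamma> :: "real \<Rightarrow> real"
  assumes U: "open U"
    and \<Omega>: "open \<Omega>" "x_of ` U \<subseteq> \<Omega>"
    and \<psi>: "smooth_on \<Omega> \<psi>"
    and p0: "p0 \<noteq> 0"
    and F: "smooth_on \<Omega> F" "\<forall>a. \<exists>x\<in>\<Omega>. F x $ a \<noteq> 0"
    and \<Gamma>: "open J" "Delta_0 \<psi> p0 ` U \<subseteq> J" "smooth_on J \<Gamma>"
  shows "is_flow_lift U (X_tilde \<psi> p0 F \<Gamma>)
           (legendre_submanifold \<Omega> \<psi>) (legendre_field \<psi> F) (\<lambda>q. legendre_map \<psi> (x_of q)) \<and>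
         (\<forall>T c. open T \<and> is_interval T \<and> c ` T \<subseteq> U \<longrightarrow>
           (integral_curve_on U (X_tilde \<psi> p0 F \<Gamma>) T c \<longleftrightarrow>
            (\<forall>t\<in>T.
               ((\<lambda>s. x_of (c s)) has_vector_derivative F (x_of (c t))) (at t) \<and>
               ((\<lambda>s. xlast_of (c s)) has_real_derivative
                  - (1 / p0) * (\<Sum>j\<in>UNIV. pd j \<psi> (x_of (c t)) * F (x_of (c t)) $ j)) (at t) \<and>
               ((\<lambda>s. plast_of (c s)) has_real_derivative
                  deriv \<Gamma> (Delta_0 \<psi> p0 (c t)) * (p0 - plast_of (c t))) (at t) \<and>
               (\<forall>a. ((\<lambda>s. Delta \<psi> p0 a (c s)) has_real_derivative
                  - (\<Sum>j\<in>UNIV. pd a (\<lambda>y. F y $ j) (x_of (c t)) * Delta \<psi> p0 j (c t))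
                  - deriv \<Gamma> (Delta_0 \<psi> p0 (c t)) * Delta \<psi> p0 a (c t)) (at t)) \<and>
               ((\<lambda>s. Delta_0 \<psi> p0 (c s)) has_real_derivative
                  - \<Gamma> (Delta_0 \<psi> p0 (c t))) (at t)))) \<and>
         is_contact_hamiltonian_field U (h_tilde \<psi> p0 F \<Gamma>) (X_tilde \<psi> p0 F \<Gamma>) \<and>
         (\<forall>q\<in>U. lie_derivative (X_tilde \<psi> p0 F \<Gamma>) (psi_tilde \<psi> p0) q = 0)"
proof (intro conjI allI impI ballI)
  have x: "x_of q \<in> \<Omega>" if "q \<in> U" for q using \<Omega>(2) that by auto
  show "is_flow_lift U (X_tilde \<psi> p0 F \<Gamma>) (legendre_submanifold \<Omega> \<psi>) (legendre_field \<psi> F)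
      (\<lambda>q. legendre_map \<psi> (x_of q))"
  proof (rule is_flow_lift_legendre[OF \<Omega>(1) \<psi> F(1) bounded_linear_fst \<Omega>(2)])
    show "x_of (X_tilde \<psi> p0 F \<Gamma> q) = F (x_of q)" for q
      by (rule X_tilde_components)
    show "lipschitz_near (X_tilde \<psi> p0 F \<Gamma>) q" if "q \<in> U" for q
      using \<Gamma>(2) that by (intro X_tilde_lipschitz_near[OF \<Omega>(1) \<psi> F(1) \<Gamma>(1,3) x]) auto
  qed
  show "is_contact_hamiltonian_field U (h_tilde \<psi> p0 F \<Gamma>) (X_tilde \<psi> p0 F \<Gamma>)"
    by (rule X_tilde_contact_hamiltonian[OF \<Omega>(1) \<psi> F(1) \<Gamma>(3) \<Omega>(2) \<Gamma>(2)])
  show "lie_derivative (X_tilde \<psi> p0 F \<Gamma>) (psi_tilde \<psi> p0) q = 0" if "q \<in> U" for q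
    unfolding lie_derivative_def
      frechet_derivative_at[OF psi_tilde_has_derivative[OF \<psi> x[OF that]], symmetric]
      X_tilde_components(1)
    by (rule psi_tilde_along_X_tilde[OF p0])
  fix T :: "real set" and c :: "real \<Rightarrow> 'n cpt"
  assume T: "open T \<and> is_interval T \<and> c ` T \<subseteq> U"
  then have c: "c t \<in> U" if "t \<in> T" for t using that by auto
  \<comment> \<open>The domain and range conditions are already given for \<open>c\<close>, so only
    the differential equation is left to be rewritten, pointwise in time.\<close>
  have "integral_curve_on U (X_tilde \<psi> p0 F \<Gamma>) T c \<longleftrightarrow>
      (\<forall>t\<in>T. (c has_vector_derivative X_tilde \<psi> p0 F \<Gamma> (c t)) (at t))"
    using T c unfolding integral_curve_on_def by blast
  also have "\<dots> \<longleftrightarrow> (\<forall>t\<in>T.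
               ((\<lambda>s. x_of (c s)) has_vector_derivative F (x_of (c t))) (at t) \<and>
               ((\<lambda>s. xlast_of (c s)) has_real_derivative
                  - (1 / p0) * (\<Sum>j\<in>UNIV. pd j \<psi> (x_of (c t)) * F (x_of (c t)) $ j)) (at t) \<and>
               ((\<lambda>s. plast_of (c s)) has_real_derivative
                  deriv \<Gamma> (Delta_0 \<psi> p0 (c t)) * (p0 - plast_of (c t))) (at t) \<and>
               (\<forall>a. ((\<lambda>s. Delta \<psi> p0 a (c s)) has_real_derivative
                  - (\<Sum>j\<in>UNIV. pd a (\<lambda>y. F y $ j) (x_of (c t)) * Delta \<psi> p0 j (c t))
                  - deriv \<Gamma> (Delta_0 \<psi> p0 (c t)) * Delta \<psi> p0 a (c t)) (at t)) \<and>
               ((\<lambda>s. Delta_0 \<psi> p0 (c s)) has_real_derivative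
                  - \<Gamma> (Delta_0 \<psi> p0 (c t))) (at t))" (is "_ \<longleftrightarrow> ?R")
    by (rule ball_cong[OF refl X_tilde_integral_curve_iff[OF p0 \<Omega>(1) \<psi> x[OF c]]])
  finally show "integral_curve_on U (X_tilde \<psi> p0 F \<Gamma>) T c \<longleftrightarrow> ?R" .
qed

end
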